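(* Let $n\ge 2$, let $0\le b<1$ be a constant and $\lambda=1-b^2$. On $N=\mathbb R^n$ with coordinates $x=(x^1,\dots,x^n)$ consider the Randers–Minkowski metric $$F(y)=\frac{\sqrt{\lambda\sum_{i=1}^n (y^i)^2+b^2(y^n)^2}-b\,y^n}{\lambda},$$ the function $\rho(x)=\sum_{a=1}^{n-1}\ln\bigl(2+\cos(\pi x^a)\bigr)$, and the conformally flat Randers metric $\widetilde F(x,y)=e^{\rho(x)}F(y)$. For any $x_0^n\in\mathbb R$ let $M=\{x\in\mathbb R^n: x^n=x_0^n\}$, with $\widetilde F$-unit normal field $\tilde{\mathbf n}=(1+b)e^{-\rho}\frac{\partial}{\partial x^n}$. Then $M$ has constant principal curvatures with respect to $\widetilde F$, but $M$ is neither an isoparametric hypersurface of $(\mathbb R^n,\widetilde F)$ nor a $d\mu$-isoparametric hypersurface of $(\mathbb R^n,\widetilde F,d\mu)$, where $d\mu=d\mu_{BH}$ is the Busemann–Hausdorff volume form of $\widetilde F$.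
   Context: For a Finsler manifold $(N,F)$ of dimension $n$ with local coordinates $(x^i,y^i)$ on $TN$, the fundamental tensor is $g_{ij}(x,y)=\frac12[F^2]_{y^iy^j}$, and $g_w=g_{ij}(x,w)dx^i\otimes dx^j$ for $w\in T_xN\setminus\{0\}$. The geodesic coefficients are $G^i=\frac14 g^{il}\{[F^2]_{x^ky^l}y^k-[F^2]_{x^l}\}$, and $N^i_j=\partial G^i/\partial y^j$. Unit-speed geodesics satisfy $\ddot\gamma^i+2G^i(\gamma,\dot\gamma)=0$, $F(\dot\gamma)=1$. Let $M\subset N$ be an embedded hypersurface with a chosen unit normal field $\mathbf n$ along $M$: $F(\mathbf n)=1$ and $g_{\mathbf n}(\mathbf n,X)=0$ for all $X\in TM$. The shape operator $A_{\mathbf n}:TM\to TM$ is defined by $D^{\mathbf n}_X\mathbf n=-A_{\mathbf n}X$, where $D$ is the covariant derivative of the Chern connection with reference vector $\mathbf n$; explicitly, $(D^{\mathbf n}_X\mathbf n)^i=X(\mathbf n^i)+N^i_j(\mathbf n)X^j$. Its eigenvalues $\mu_1,\dots,\mu_{n-1}$ are the principal curvatures and $\hat H_{\mathbf n}=\sum_{a=1}^{n-1}\mu_a$ is the anisotropic mean curvature. For a volume form $d\mu=\sigma(x)dx^1\wedge\cdots\wedge dx^n$, the $\mathbf S$-curvature is $S(x,y)=\frac{\partial G^i}{\partial y^i}-y^i\frac{\partial}{\partial x^i}\ln\sigma(x)$, and the $d\mu$-mean curvature of $M$ is $H_{\mathbf n}=\hat H_{\mathbf n}+S(\mathbf n)$.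 The Busemann–Hausdorff volume form has $\sigma(x)=\mathrm{Vol}(\mathbb B^n)/\mathrm{Vol}\{y\in\mathbb R^n:F(x,y)<1\}$, with Euclidean volumes and $\mathbb B^n$ the Euclidean unit ball. For small $t>0$, the parallel hypersurface $M_t$ at distance $t$ consists of the points $\gamma_p(t)$, $p\in M$, where $\gamma_p$ is the unit-speed geodesic with $\gamma_p(0)=p$, $\dot\gamma_p(0)=\mathbf n(p)$; it carries the unit normal field $\dot\gamma_p(t)$. $M$ is isoparametric if $M$ and all its sufficiently close parallel hypersurfaces $M_t$ have constant anisotropic mean curvature; $M$ is $d\mu$-isoparametric if $M$ and all its sufficiently close parallel hypersurfaces $M_t$ have constant $d\mu$-mean curvature. *)

theory Defs
  imports "HOL-Analysis.Analysis" "HOL-Library.Multiset"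
begin

section \<open>Smooth functions and embedded hypersurfaces of coordinate space\<close>

definition partial :: "'n::finite \<Rightarrow> (real^'n \<Rightarrow> real) \<Rightarrow> real^'n \<Rightarrow> real" where
  "partial i f x = deriv (\<lambda>t. f (x + t *\<^sub>R axis i 1)) 0"

text \<open>\<open>Ck_on k U f\<close> is the usual class of \<open>k\<close> times continuously differentiable functions only for
  open \<open>U\<close>; it is only used for such sets.\<close>

fun Ck_on :: "nat \<Rightarrow> (real^'n::finite) set \<Rightarrow> (real^'n \<Rightarrow> real) \<Rightarrow> bool" where
  "Ck_on 0 U f \<longleftrightarrow> continuous_on U f"
| "Ck_on (Suc k) U f \<longleftrightarrow> (\<forall>x\<in>U. f differentiable (at x)) \<and> (\<forall>i. Ck_on k U (partial i f))"

definition smooth_on :: "(real^'n::finite) set \<Rightarrow> (real^'n \<Rightarrow> real^'n) \<Rightarrow> bool" where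
  "smooth_on U f \<longleftrightarrow> (\<forall>k i. Ck_on k U (\<lambda>x. f x $ i))"

text \<open>Embedded hypersurfaces are given by slice charts: \<open>\<Phi>\<close> straightens \<open>M\<close> near \<open>p\<close> to a
  coordinate hyperplane.\<close>

definition embedded_hypersurface :: "(real^'n::finite) set \<Rightarrow> bool" where
  "embedded_hypersurface M \<longleftrightarrow>
     (\<forall>p\<in>M. \<exists>U V \<Phi> \<Psi> k. open U \<and> open V \<and> p \<in> U \<and>
        homeomorphism U V \<Phi> \<Psi> \<and> smooth_on U \<Phi> \<and> smooth_on V \<Psi> \<and>
        \<Phi> ` (M \<inter> U) = {y \<in> V. y $ k = 0})"

definition smooth_along :: "(real^'n::finite) set \<Rightarrow> (real^'n \<Rightarrow> real^'n) \<Rightarrow> bool" where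
  "smooth_along M f \<longleftrightarrow>
     (\<forall>p\<in>M. \<exists>U h. open U \<and> p \<in> U \<and> smooth_on U h \<and> (\<forall>x\<in>M \<inter> U. f x = h x))"

definition tangent_space :: "(real^'n::finite) set \<Rightarrow> real^'n \<Rightarrow> (real^'n) set" where
  "tangent_space M p = {X. \<exists>c e. 0 < e \<and> (\<forall>t. \<bar>t\<bar> < e \<longrightarrow> c t \<in> M) \<and> c 0 = p \<and>
                           (c has_vector_derivative X) (at 0)}"

section \<open>Finsler geometry in global coordinates\<close>

text \<open>A metric on \<open>\<real>\<^sup>n\<close> is a function \<open>F x y\<close> of the point \<open>x\<close> and the tangent vector \<open>y\<close>.
  It need not be smooth at \<open>y = 0\<close>; all quantities below are meant for \<open>y \<noteq> 0\<close>.\<close>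

type_synonym 'n metric = "real^'n \<Rightarrow> real^'n \<Rightarrow> real"

definition fundamental_tensor :: "('n::finite) metric \<Rightarrow> real^'n \<Rightarrow> real^'n \<Rightarrow> real^'n^'n" where
  "fundamental_tensor F x y =
     (\<chi> i j. 1/2 * partial j (partial i (\<lambda>v. (F x v)\<^sup>2)) y)"

definition finsler_inner ::
    "('n::finite) metric \<Rightarrow> real^'n \<Rightarrow> real^'n \<Rightarrow> real^'n \<Rightarrow> real^'n \<Rightarrow> real" where
  "finsler_inner F x w X Y = (\<Sum>i\<in>UNIV. \<Sum>j\<in>UNIV. fundamental_tensor F x w $ i $ j * X $ i * Y $ j)"

definition geodesic_coeff :: "('n::finite) metric \<Rightarrow> real^'n \<Rightarrow> real^'n \<Rightarrow> real^'n" where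
  "geodesic_coeff F x y =
     (\<chi> i. 1/4 * (\<Sum>l\<in>UNIV. matrix_inv (fundamental_tensor F x y) $ i $ l *
        ((\<Sum>k\<in>UNIV. partial k (\<lambda>z. partial l (\<lambda>v. (F z v)\<^sup>2) y) x * y $ k)
          - partial l (\<lambda>z. (F z y)\<^sup>2) x)))"

definition nonlinear_connection :: "('n::finite) metric \<Rightarrow> real^'n \<Rightarrow> real^'n \<Rightarrow> real^'n^'n" where
  "nonlinear_connection F x y = (\<chi> i j. partial j (\<lambda>v. geodesic_coeff F x v $ i) y)"

definition unit_speed_geodesic_on ::
    "('n::finite) metric \<Rightarrow> real set \<Rightarrow> (real \<Rightarrow> real^'n) \<Rightarrow> (real \<Rightarrow> real^'n) \<Rightarrow> bool" where
  "unit_speed_geodesic_on F I \<gamma> \<gamma>' \<longleftrightarrow>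
     (\<forall>s\<in>I. (\<gamma> has_vector_derivative \<gamma>' s) (at s within I) \<and>
            (\<gamma>' has_vector_derivative (- 2) *\<^sub>R geodesic_coeff F (\<gamma> s) (\<gamma>' s)) (at s within I) \<and>
            F (\<gamma> s) (\<gamma>' s) = 1)"

section \<open>Hypersurfaces with a unit normal field\<close>

definition unit_normal_field ::
    "('n::finite) metric \<Rightarrow> (real^'n) set \<Rightarrow> (real^'n \<Rightarrow> real^'n) \<Rightarrow> bool" where
  "unit_normal_field F M \<nu> \<longleftrightarrow> smooth_along M \<nu> \<and>
     (\<forall>p\<in>M. F p (\<nu> p) = 1 \<and> (\<forall>X\<in>tangent_space M p. finsler_inner F p (\<nu> p) (\<nu> p) X = 0))"

definition normal_hypersurface ::
    "('n::finite) metric \<Rightarrow> (real^'n) set \<Rightarrow> (real^'n \<Rightarrow> real^'n) \<Rightarrow> bool" where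
  "normal_hypersurface F M \<nu> \<longleftrightarrow> embedded_hypersurface M \<and> unit_normal_field F M \<nu>"

text \<open>\<open>frechet_derivative \<nu> (at p within M)\<close> is determined only on vectors tangent to \<open>M\<close>,
  where it is the derivative of \<open>\<nu>\<close> along \<open>M\<close>. Hence \<open>shape_operator\<close> is meaningful
  only for \<open>X \<in> tangent_space M p\<close>.\<close>

definition shape_operator ::
    "('n::finite) metric \<Rightarrow> (real^'n) set \<Rightarrow> (real^'n \<Rightarrow> real^'n) \<Rightarrow> real^'n \<Rightarrow> real^'n \<Rightarrow> real^'n" where
  "shape_operator F M \<nu> p X =
     - (frechet_derivative \<nu> (at p within M) X + nonlinear_connection F p (\<nu> p) *v X)"

text \<open>The eigenvalues are counted with geometric multiplicity, which is the algebraic one because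
  the shape operator is self-adjoint for \<open>g\<^sub>\<nu>\<close>.\<close>

definition principal_curvatures ::
    "('n::finite) metric \<Rightarrow> (real^'n) set \<Rightarrow> (real^'n \<Rightarrow> real^'n) \<Rightarrow> real^'n \<Rightarrow> real multiset" where
  "principal_curvatures F M \<nu> p =
     (THE \<mu>. \<forall>\<kappa>. count \<mu> \<kappa> = dim {X \<in> tangent_space M p. shape_operator F M \<nu> p X = \<kappa> *\<^sub>R X})"

definition constant_principal_curvatures ::
    "('n::finite) metric \<Rightarrow> (real^'n) set \<Rightarrow> (real^'n \<Rightarrow> real^'n) \<Rightarrow> bool" where
  "constant_principal_curvatures F M \<nu> \<longleftrightarrow>
     (\<exists>\<mu>. size \<mu> = CARD('n) - 1 \<and> (\<forall>p\<in>M. principal_curvatures F M \<nu> p = \<mu>))"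

definition anisotropic_mean_curvature ::
    "('n::finite) metric \<Rightarrow> (real^'n) set \<Rightarrow> (real^'n \<Rightarrow> real^'n) \<Rightarrow> real^'n \<Rightarrow> real" where
  "anisotropic_mean_curvature F M \<nu> p = sum_mset (principal_curvatures F M \<nu> p)"

section \<open>Volume forms\<close>

text \<open>A volume form is represented by its density \<open>\<sigma>\<close> with respect to the coordinates.\<close>

definition S_curvature ::
    "('n::finite) metric \<Rightarrow> (real^'n \<Rightarrow> real) \<Rightarrow> real^'n \<Rightarrow> real^'n \<Rightarrow> real" where
  "S_curvature F \<sigma> x y =
     (\<Sum>i\<in>UNIV. partial i (\<lambda>v. geodesic_coeff F x v $ i) y)
       - (\<Sum>i\<in>UNIV. y $ i * partial i (\<lambda>z. ln (\<sigma> z)) x)"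

definition dmu_mean_curvature ::
    "('n::finite) metric \<Rightarrow> (real^'n \<Rightarrow> real) \<Rightarrow> (real^'n) set \<Rightarrow> (real^'n \<Rightarrow> real^'n) \<Rightarrow> real^'n \<Rightarrow> real" where
  "dmu_mean_curvature F \<sigma> M \<nu> p = anisotropic_mean_curvature F M \<nu> p + S_curvature F \<sigma> p (\<nu> p)"

definition busemann_hausdorff :: "('n::finite) metric \<Rightarrow> real^'n \<Rightarrow> real" where
  "busemann_hausdorff F x =
     measure lebesgue (ball (0::real^'n) 1) / measure lebesgue {y::real^'n. F x y < 1}"

section \<open>Parallel and isoparametric hypersurfaces\<close>

text \<open>The point \<open>x = \<gamma>\<^sub>p(t)\<close> and the velocity \<open>v = \<gamma>\<^sub>p'(t)\<close> of a normal geodesic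
  issuing from some \<open>p \<in> M\<close>.\<close>

definition normal_geodesic_reaches ::
    "('n::finite) metric \<Rightarrow> (real^'n) set \<Rightarrow> (real^'n \<Rightarrow> real^'n) \<Rightarrow> real \<Rightarrow> real^'n \<Rightarrow> real^'n \<Rightarrow> bool" where
  "normal_geodesic_reaches F M \<nu> t x v \<longleftrightarrow>
     (\<exists>\<gamma> \<gamma>'. unit_speed_geodesic_on F {0..t} \<gamma> \<gamma>' \<and> \<gamma> 0 \<in> M \<and> \<gamma>' 0 = \<nu> (\<gamma> 0) \<and>
             \<gamma> t = x \<and> \<gamma>' t = v)"

definition parallel_hypersurface ::
    "('n::finite) metric \<Rightarrow> (real^'n) set \<Rightarrow> (real^'n \<Rightarrow> real^'n) \<Rightarrow> real \<Rightarrow> (real^'n) set" where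
  "parallel_hypersurface F M \<nu> t = {x. \<exists>v. normal_geodesic_reaches F M \<nu> t x v}"

text \<open>In the next two definitions \<open>H M \<nu> p\<close> is a notion of mean curvature at \<open>p\<close> of the
  hypersurface \<open>M\<close> with unit normal field \<open>\<nu>\<close>.\<close>

definition has_constant_curvature ::
    "((real^'n) set \<Rightarrow> (real^'n \<Rightarrow> real^'n) \<Rightarrow> real^'n \<Rightarrow> real) \<Rightarrow>
     ('n::finite) metric \<Rightarrow> (real^'n) set \<Rightarrow> (real^'n \<Rightarrow> real^'n) \<Rightarrow> bool" where
  "has_constant_curvature H F M \<nu> \<longleftrightarrow> normal_hypersurface F M \<nu> \<and> (\<exists>c. \<forall>p\<in>M. H M \<nu> p = c)"

definition parallels_have_constant_curvature ::
    "((real^'n) set \<Rightarrow> (real^'n \<Rightarrow> real^'n) \<Rightarrow> real^'n \<Rightarrow> real) \<Rightarrow>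
     ('n::finite) metric \<Rightarrow> (real^'n) set \<Rightarrow> (real^'n \<Rightarrow> real^'n) \<Rightarrow> bool" where
  "parallels_have_constant_curvature H F M \<nu> \<longleftrightarrow>
     has_constant_curvature H F M \<nu> \<and>
     (\<exists>\<epsilon>>0. \<forall>t. 0 < t \<and> t < \<epsilon> \<longrightarrow>
        (\<exists>\<nu>'. (\<forall>x v. normal_geodesic_reaches F M \<nu> t x v \<longrightarrow> \<nu>' x = v) \<and>
              has_constant_curvature H F (parallel_hypersurface F M \<nu> t) \<nu>'))"

definition isoparametric ::
    "('n::finite) metric \<Rightarrow> (real^'n) set \<Rightarrow> (real^'n \<Rightarrow> real^'n) \<Rightarrow> bool" where
  "isoparametric F = parallels_have_constant_curvature (anisotropic_mean_curvature F) F"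

definition dmu_isoparametric ::
    "('n::finite) metric \<Rightarrow> (real^'n \<Rightarrow> real) \<Rightarrow> (real^'n) set \<Rightarrow> (real^'n \<Rightarrow> real^'n) \<Rightarrow> bool" where
  "dmu_isoparametric F \<sigma> = parallels_have_constant_curvature (dmu_mean_curvature F \<sigma>) F"

end

theory Submission
  imports Defs
begin

text \<open>At \<open>x\<close> the gradient of \<open>\<rho>\<close> is tangent to the hyperplanes \<open>x $ m = const\<close>, and the Cartan tensor of
  \<open>F\<close> vanishes at \<open>axis m 1\<close> by symmetry; hence the derivative of \<open>nt\<close> cancels against the nonlinear
  connection and all principal curvatures of \<open>M\<close> are \<open>0\<close>.

  Over a critical point of \<open>\<rho>\<close> the normal geodesic is a straight line, while nearby normal geodesics
  are attracted by the maxima of \<open>\<rho>\<close> and repelled by the minima, like light rays in a medium of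
  refractive index \<open>exp \<rho>\<close>. So the parallel hypersurfaces have positive mean curvature over
  a maximum and negative mean curvature over a minimum. At these points the S-curvature vanishes.
  To compute the derivative of the normal field it suffices to follow
  the geodesics that start on coordinate lines through the critical point: they stay in a plane, where
  the flow is a globally Lipschitz system on \<open>\<real>\<^sup>2\<close>.\<close>

section \<open>Ordinary differential equations, smooth functions and hypersurfaces\<close>

text \<open>The parallel hypersurfaces are never parametrized. Isoparametricity, assumed for
  contradiction, asserts that they are embedded, that their normal field is smooth along them, and
  that it equals the velocity at every point reached by a normal geodesic. What remains is to
  exhibit enough geodesics: the derivative of the field at one point is then read off from
  difference quotients along a sequence of reached points. Only signs matter. At a critical point of
  type \<open>\<sigma>\<close> the mean curvature has the sign of \<open>\<sigma>\<close>, and one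
  constant cannot have both signs; so one-sided estimates suffice and the constants may be crude.
  The time bound 1/100 makes the Picard map a contraction and keeps the displacement along
  \<open>axis a 1\<close> between 2/3 and 4/3 of its initial value. The Randers norm is handled in
  Zermelo form: y minus the drift \<open>b * F y\<close> along \<open>axis m 1\<close> has Euclidean
  length \<open>F y\<close>. This replaces square roots by rational identities between F, Q and
  inner products.\<close>

lemma picard_global:
  fixes f :: "'a::{banach} \<Rightarrow> 'a" and u0 :: 'a
  assumes lip: "\<And>x y. norm (f x - f y) \<le> K * norm (x - y)"
    and K: "0 \<le> K" and T: "0 \<le> T" "K * T < 1"
  shows "\<exists>u. u 0 = u0 \<and> (\<forall>t\<in>{0..T}. (u has_vector_derivative f (u t)) (at t within {0..T}))"
proof -
  have contf: "continuous_on S f" for S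
  proof (rule lipschitz_on_continuous_on)
    show "K-lipschitz_on S f"
      using lip K by (auto simp: lipschitz_on_def dist_norm)
  qed
  \<comment> \<open>Bounded continuous functions are a complete metric space on the whole real line;
    clamping time to [0,T] turns a continuous function on the interval into one of them.\<close>
  define cl where "cl t = max 0 (min T t)" for t :: real
  have cl: "cl t \<in> {0..T}" for t using T by (auto simp: cl_def)
  have cl_id: "cl t = t" if "t \<in> {0..T}" for t using that by (auto simp: cl_def)
  define I where "I u t = u0 + integral {0..t} (\<lambda>s. f (apply_bcontfun u s))"
    for u :: "real \<Rightarrow>\<^sub>C 'a" and t
  have contu: "continuous_on S (\<lambda>s. f (apply_bcontfun u s))" for u :: "real \<Rightarrow>\<^sub>C 'a" and S
    by (rule continuous_on_compose2[OF contf[of UNIV] continuous_on_apply_bcontfun]) auto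
  have contI: "continuous_on {0..T} (I u)" for u
    unfolding I_def
    by (intro continuous_intros indefinite_integral_continuous_1 integrable_continuous_interval contu)
  have mem: "(\<lambda>t. I u (cl t)) \<in> bcontfun" for u
  proof -
    have "continuous_on UNIV (\<lambda>t. I u (cl t))"
      by (rule continuous_on_compose2[OF contI[of u]])
        (use cl in \<open>auto simp: cl_def intro!: continuous_intros\<close>)
    moreover have "bounded (range (\<lambda>t. I u (cl t)))"
      by (rule bounded_subset[OF compact_imp_bounded[OF compact_continuous_image[OF contI[of u] compact_Icc]]])
        (use cl in auto)
    ultimately show ?thesis by (simp add: bcontfun_def)
  qed
  define P where "P u = Bcontfun (\<lambda>t. I u (cl t))" for u
  have P: "apply_bcontfun (P u) t = I u (cl t)" for u t
    unfolding P_def by (simp add: Bcontfun_inverse[OF mem])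
  \<comment> \<open>Integrating a K-Lipschitz integrand over a time of at most T gives the factor K
    * T, so the plain sup metric is contracted.\<close>
  have "dist (P u) (P v) \<le> (K * T) * dist u v" for u v
  proof (rule dist_bound)
    fix t
    have int: "(\<lambda>s. f (apply_bcontfun u s)) integrable_on {0..cl t}" for u
      by (intro integrable_continuous_interval contu)
    have "dist (P u t) (P v t) = norm (integral {0..cl t} (\<lambda>s. f (apply_bcontfun u s) - f (apply_bcontfun v s)))"
      unfolding P I_def dist_norm by (simp add: integral_diff[OF int int])
    also have "\<dots> \<le> (K * dist u v) * (cl t - 0)"
    proof (rule integral_bound)
      show "0 \<le> cl t" using cl[of t] by auto
      show "continuous_on {0..cl t} (\<lambda>s. f (apply_bcontfun u s) - f (apply_bcontfun v s))"
        by (intro continuous_intros contu)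
      show "norm (f (apply_bcontfun u s) - f (apply_bcontfun v s)) \<le> K * dist u v" for s
        using lip[of "u s" "v s"] mult_left_mono[OF dist_bounded[of u s v] K]
        by (simp add: dist_norm)
    qed
    also have "\<dots> \<le> (K * dist u v) * T"
      by (intro mult_left_mono mult_nonneg_nonneg K) (use cl[of t] in auto)
    finally show "dist (P u t) (P v t) \<le> (K * T) * dist u v" by (simp add: ac_simps)
  qed
  then have "\<exists>!u. P u = u"
    by (intro banach_fix_type[of "K * T"]) (use K T in auto)
  then obtain u where u: "P u = u" by blast
  have eq: "apply_bcontfun u t = I u t" if "t \<in> {0..T}" for t
    using P[of u t] u cl_id[OF that] by simp
  show ?thesis
  proof (intro exI[of _ "apply_bcontfun u"] conjI ballI)
    show "apply_bcontfun u 0 = u0" using eq[of 0] T by (simp add: I_def)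
    fix t assume t: "t \<in> {0..T}"
    have "((\<lambda>t. u0 + integral {0..t} (\<lambda>s. f (apply_bcontfun u s))) has_vector_derivative
        0 + f (apply_bcontfun u t)) (at t within {0..T})"
      by (intro has_vector_derivative_add has_vector_derivative_const
          integral_has_vector_derivative contu t)
    then have "(I u has_vector_derivative f (apply_bcontfun u t)) (at t within {0..T})"
      by (simp add: I_def[abs_def])
    then show "(apply_bcontfun u has_vector_derivative f (apply_bcontfun u t)) (at t within {0..T})"
      by (rule has_vector_derivative_transform[OF t _, rotated]) (simp add: eq)
  qed
qed

section \<open>Partial derivatives and functions of class \<open>Ck_on\<close> on the whole
  space\<close>

lemma partial_eq:
  assumes "(f has_derivative D) (at x)"
  shows "partial i f x = D (axis i 1)"
proof -
  have D: "linear D" using assms by (simp add: has_derivative_linear)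
  have "((\<lambda>t. f (x + t *\<^sub>R axis i 1)) has_derivative (\<lambda>t. D (t *\<^sub>R axis i 1))) (at 0)"
    by (rule has_derivative_compose[of "\<lambda>t. x + t *\<^sub>R axis i 1", simplified])
      (use assms in \<open>auto intro!: derivative_eq_intros\<close>)
  then have "((\<lambda>t. f (x + t *\<^sub>R axis i 1)) has_real_derivative D (axis i 1)) (at 0)"
    by (simp add: has_field_derivative_def linear_scale[OF D] mult_commute_abs)
  then show ?thesis unfolding partial_def by (rule DERIV_imp_deriv)
qed

lemma partial_eqI:
  assumes "((\<lambda>t. f (x + t *\<^sub>R axis i 1)) has_real_derivative d) (at 0)"
  shows "partial i f x = d"
  unfolding partial_def by (rule DERIV_imp_deriv[OF assms])

text \<open>The closed formulas for the Finsler quantities hold only at nonzero vectors. To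
  differentiate such a formula once more, agreement near the point on the coordinate line is
  enough.\<close>

lemma partial_cong_ev:
  assumes "eventually (\<lambda>t. f (x + t *\<^sub>R axis i 1) = g (x + t *\<^sub>R axis i 1)) (nhds 0)"
  shows "partial i f x = partial i g x"
  unfolding partial_def using assms by (intro deriv_cong_ev) auto

lemma Ck_on_Suc_imp: "Ck_on (Suc k) U f \<Longrightarrow> Ck_on k U f"
proof (induction k arbitrary: f)
  case 0
  then show ?case
    by (auto intro!: continuous_at_imp_continuous_on differentiable_imp_continuous_within)
next
  case (Suc k)
  note * = Suc.prems[unfolded Ck_on.simps(2)[of "Suc k"]]
  show ?case unfolding Ck_on.simps(2)[of k] using * Suc.IH by blast
qed

lemma Ck_on_const: "Ck_on k UNIV (\<lambda>x::real^'n::finite. c)"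
proof (induction k arbitrary: c)
  case (Suc k)
  have "partial i (\<lambda>x::real^'n. c) = (\<lambda>x. 0)" for i
    using partial_eq[OF has_derivative_const] by auto
  with Suc show ?case by simp
qed simp

lemma Ck_on_add:
  assumes "Ck_on k UNIV f" "Ck_on k UNIV g"
  shows "Ck_on k UNIV (\<lambda>x::real^'n::finite. f x + g x)"
  using assms
proof (induction k arbitrary: f g)
  case 0 then show ?case by (auto intro: continuous_intros)
next
  case (Suc k)
  then have d: "\<And>x. f differentiable (at x)" "\<And>x. g differentiable (at x)" by auto
  have "partial i (\<lambda>x. f x + g x) = (\<lambda>x. partial i f x + partial i g x)" for i
  proof
    fix x
    obtain D E where *: "(f has_derivative D) (at x)" "(g has_derivative E) (at x)"
      using d[of x] by (auto simp: differentiable_def)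
    show "partial i (\<lambda>x. f x + g x) x = partial i f x + partial i g x"
      using partial_eq[OF *(1)] partial_eq[OF *(2)] partial_eq[OF has_derivative_add[OF *]] by simp
  qed
  with Suc d show ?case by auto
qed

lemma Ck_on_mult:
  assumes "Ck_on k UNIV f" "Ck_on k UNIV g"
  shows "Ck_on k UNIV (\<lambda>x::real^'n::finite. f x * g x)"
  using assms
proof (induction k arbitrary: f g)
  case 0 then show ?case by (auto intro: continuous_intros)
next
  case (Suc k)
  then have d: "\<And>x. f differentiable (at x)" "\<And>x. g differentiable (at x)" by auto
  have "partial i (\<lambda>x. f x * g x) = (\<lambda>x. f x * partial i g x + partial i f x * g x)" for i
  proof
    fix x
    obtain D E where *: "(f has_derivative D) (at x)" "(g has_derivative E) (at x)"
      using d[of x] by (auto simp: differentiable_def)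
    show "partial i (\<lambda>x. f x * g x) x = f x * partial i g x + partial i f x * g x"
      using partial_eq[OF *(1)] partial_eq[OF *(2)] partial_eq[OF has_derivative_mult[OF *]] by simp
  qed
  moreover have "Ck_on k UNIV f" "Ck_on k UNIV g" using Suc.prems Ck_on_Suc_imp by blast+
  ultimately show ?case using Suc d by (auto intro!: Ck_on_add Suc.IH)
qed

lemma Ck_on_minus:
  assumes "Ck_on k UNIV f"
  shows "Ck_on k UNIV (\<lambda>x::real^'n::finite. - f x)"
  using Ck_on_mult[OF Ck_on_const[of k "- 1"] assms] by simp

lemma Ck_on_prod:
  assumes "finite A" "\<And>a. a \<in> A \<Longrightarrow> Ck_on k UNIV (f a)"
  shows "Ck_on k UNIV (\<lambda>x::real^'n::finite. \<Prod>a\<in>A. f a x)"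
  using assms by (induction A rule: finite_induct) (auto intro!: Ck_on_const Ck_on_mult)

lemma has_derivative_coord:
  assumes "(\<phi> has_real_derivative d) (at (x $ a))"
  shows "((\<lambda>x::real^'n::finite. \<phi> (x $ a)) has_derivative (\<lambda>h. d * h $ a)) (at x)"
  using has_derivative_compose[of "\<lambda>x::real^'n. x $ a" "\<lambda>h. h $ a" x UNIV \<phi> "(*) d"] assms
  by (simp add: has_field_derivative_def bounded_linear_imp_has_derivative bounded_linear_vec_nth)

lemma Ck_on_coord: "Ck_on k UNIV (\<lambda>x::real^'n::finite. x $ a + c)"
proof (cases k)
  case (Suc k)
  have *: "((\<lambda>x::real^'n. x $ a + c) has_derivative (\<lambda>h. 1 * h $ a)) (at x)" for x
    by (rule has_derivative_coord) (auto intro!: derivative_eq_intros)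
  have "partial i (\<lambda>x::real^'n. x $ a + c) = (\<lambda>x. axis i 1 $ a)" for i
    using partial_eq[OF *] by (auto simp: fun_eq_iff)
  with Suc * show ?thesis by (auto simp: Ck_on_const differentiable_def)
qed (auto intro!: continuous_intros)

text \<open>The three functions are treated together because their partial derivatives are
  polynomials in the three of them, so a simultaneous induction on k closes. The inverse occurs
  because \<open>exp (- \<rho> x)\<close> is a product of such factors.\<close>

lemma Ck_on_trig:
  "Ck_on k UNIV (\<lambda>x::real^'n::finite. cos (pi * x $ a)) \<and>
   Ck_on k UNIV (\<lambda>x::real^'n. sin (pi * x $ a)) \<and>
   Ck_on k UNIV (\<lambda>x::real^'n. inverse (2 + cos (pi * x $ a)))"
proof (induction k)
  case 0
  have "2 + cos (pi * x $ a) \<noteq> 0" for x :: "real^'n"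
    using cos_ge_minus_one[of "pi * x $ a"] by linarith
  then show ?case by (auto intro!: continuous_intros)
next
  case (Suc k)
  have pos: "2 + cos (pi * x $ a) \<noteq> 0" for x :: "real^'n"
    using cos_ge_minus_one[of "pi * x $ a"] by linarith
  have 1: "((\<lambda>x::real^'n. cos (pi * x $ a)) has_derivative (\<lambda>h. (- pi * sin (pi * x $ a)) * h $ a)) (at x)" for x
    by (rule has_derivative_coord[where \<phi> = "\<lambda>t. cos (pi * t)"]) (auto intro!: derivative_eq_intros)
  have 2: "((\<lambda>x::real^'n. sin (pi * x $ a)) has_derivative (\<lambda>h. (pi * cos (pi * x $ a)) * h $ a)) (at x)" for x
    by (rule has_derivative_coord[where \<phi> = "\<lambda>t. sin (pi * t)"]) (auto intro!: derivative_eq_intros)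
  have 3: "((\<lambda>x::real^'n. inverse (2 + cos (pi * x $ a))) has_derivative
     (\<lambda>h. (pi * sin (pi * x $ a) * (inverse (2 + cos (pi * x $ a)) * inverse (2 + cos (pi * x $ a)))) * h $ a)) (at x)" for x
    by (rule has_derivative_coord[where \<phi> = "\<lambda>t. inverse (2 + cos (pi * t))"])
      (use pos[of x] in \<open>auto intro!: derivative_eq_intros simp: field_simps\<close>)
  have ax: "Ck_on k UNIV (\<lambda>x::real^'n. axis i 1 $ a)" for i by (rule Ck_on_const)
  show ?case
    using Suc.IH 1 2 3 partial_eq[OF 1, abs_def] partial_eq[OF 2, abs_def] partial_eq[OF 3, abs_def]
    by (auto simp: differentiable_def intro!: Ck_on_mult Ck_on_minus Ck_on_const ax)
qed

section \<open>Hypersurfaces: tangent spaces, eigenvalues, derivatives along sequences\<close>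

lemma smooth_on_differentiable:
  fixes f :: "real^'n::finite \<Rightarrow> real^'n"
  assumes "smooth_on U f" "x \<in> U"
  shows "f differentiable (at x)"
proof -
  have "\<forall>i. (\<lambda>x. f x $ i) differentiable (at x)"
  proof
    fix i
    have "Ck_on (Suc 0) U (\<lambda>x. f x $ i)" using assms(1) unfolding smooth_on_def by blast
    then show "(\<lambda>x. f x $ i) differentiable (at x)" using assms(2) by simp
  qed
  then obtain D where D: "\<And>i. ((\<lambda>x. f x $ i) has_derivative D i) (at x)"
    unfolding differentiable_def by metis
  have "(f has_derivative (\<lambda>h. \<chi> i. D i h)) (at x)"
    by (rule has_derivative_componentwise_within[THEN iffD2])
      (auto simp: Basis_vec_def inner_axis D)
  then show ?thesis unfolding differentiable_def by blast
qed

text \<open>Dimension count: \<open>tangent_space\<close> is a set of velocities and not visibly a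
  subspace. The derivative B of the inverse chart is injective and carries the slice hyperplane to
  velocities of the curves \<open>\<Psi> (\<Phi> p + t *\<^sub>R Y)\<close> in M. This gives an
  (n-1)-dimensional subspace of tangent vectors, which must fill the hyperplane known to contain
  them.\<close>

lemma tangent_space_chart:
  fixes M :: "(real^'n::finite) set"
  assumes M: "embedded_hypersurface M" "p \<in> M"
    and sub: "tangent_space M p \<subseteq> {X. X $ m = 0}"
  shows "tangent_space M p = {X. X $ m = 0}"
proof -
  obtain U V \<Phi> \<Psi> k where U: "open U" "open V" "p \<in> U" and hom: "homeomorphism U V \<Phi> \<Psi>"
    and sm: "smooth_on U \<Phi>" "smooth_on V \<Psi>" and im: "\<Phi> ` (M \<inter> U) = {y \<in> V. y $ k = 0}"
    using M(1)[unfolded embedded_hypersurface_def, THEN bspec, OF M(2)] by (elim exE conjE) (rule that)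
  have \<Psi>\<Phi>: "\<Psi> (\<Phi> x) = x" if "x \<in> U" for x using hom that by (auto simp: homeomorphism_def)
  have \<Phi>\<Psi>: "\<Phi> (\<Psi> y) = y" if "y \<in> V" for y using hom that by (auto simp: homeomorphism_def)
  have pV: "\<Phi> p \<in> V" using hom U by (auto simp: homeomorphism_def)
  have pk: "\<Phi> p $ k = 0" using im M U by blast
  obtain A where A: "(\<Phi> has_derivative A) (at p)"
    using smooth_on_differentiable[OF sm(1) U(3)] by (auto simp: differentiable_def)
  obtain B where B: "(\<Psi> has_derivative B) (at (\<Phi> p))"
    using smooth_on_differentiable[OF sm(2) pV] by (auto simp: differentiable_def)
  have lB: "linear B" using B by (rule has_derivative_linear)
  have "((\<lambda>y. \<Phi> (\<Psi> y)) has_derivative (\<lambda>h. A (B h))) (at (\<Phi> p))"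
    using has_derivative_compose[OF B, of \<Phi> A] A \<Psi>\<Phi>[OF U(3)] by simp
  then have "((\<lambda>y. y) has_derivative (\<lambda>h. A (B h))) (at (\<Phi> p))"
    by (rule has_derivative_transform_within_open[OF _ U(2) pV]) (simp add: \<Phi>\<Psi>)
  then have "(\<lambda>h. A (B h)) = (\<lambda>h. h)"
    using has_derivative_unique has_derivative_ident by blast
  then have injB: "inj B" by (metis injI)
  define W where "W = {Y::real^'n. Y $ k = 0}"
  have dimW: "dim {Y::real^'n. Y $ i = 0} = CARD('n) - 1" for i
  proof -
    have "{Y::real^'n. Y $ i = 0} = {Y. axis i 1 \<bullet> Y = 0}" by (auto simp: inner_axis')
    then show ?thesis by (simp add: dim_hyperplane)
  qed
  have sW: "subspace {Y::real^'n. Y $ i = 0}" for i by (auto simp: subspace_def)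
  have BW: "B ` W \<subseteq> tangent_space M p"
  proof
    fix X assume "X \<in> B ` W"
    then obtain Y where Y: "Y $ k = 0" "X = B Y" by (auto simp: W_def)
    let ?l = "\<lambda>t::real. \<Phi> p + t *\<^sub>R Y"
    have "continuous_on UNIV ?l" by (intro continuous_intros)
    then have "open (?l -` V)" using U(2) by (rule open_vimage[rotated])
    moreover have "0 \<in> ?l -` V" using pV by simp
    ultimately obtain e where e0: "0 < e" "ball 0 e \<subseteq> ?l -` V" by (rule openE)
    have e: "0 < e" "\<And>t. \<bar>t\<bar> < e \<Longrightarrow> ?l t \<in> V"
      using e0 by (auto simp: subset_iff dist_real_def)
    have "\<Psi> (?l t) \<in> M" if "\<bar>t\<bar> < e" for t
    proof -
      have "?l t \<in> \<Phi> ` (M \<inter> U)" using e(2)[OF that] im pk Y by auto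
      then show ?thesis using \<Psi>\<Phi> by auto
    qed
    moreover have "((\<lambda>t. \<Psi> (?l t)) has_vector_derivative X) (at 0)"
    proof -
      have "(?l has_derivative (\<lambda>t. t *\<^sub>R Y)) (at 0)" by (auto intro!: derivative_eq_intros)
      then have "((\<lambda>t. \<Psi> (?l t)) has_derivative (\<lambda>t. B (t *\<^sub>R Y))) (at 0)"
        using has_derivative_compose[of ?l _ 0 UNIV \<Psi> B] B by simp
      then show ?thesis by (simp add: has_vector_derivative_def linear_scale[OF lB] Y)
    qed
    ultimately show "X \<in> tangent_space M p"
      unfolding tangent_space_def using e(1) \<Psi>\<Phi>[OF U(3)]
      by (intro CollectI exI[of _ "\<lambda>t. \<Psi> (?l t)"] exI[of _ e]) auto
  qed
  have "B ` W = {X. X $ m = 0}"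
  proof (rule subspace_dim_equal)
    show "subspace (B ` W)" unfolding W_def by (rule linear_subspace_image[OF lB sW])
    show "B ` W \<subseteq> {X. X $ m = 0}" using BW sub by blast
    show "dim {X::real^'n. X $ m = 0} \<le> dim (B ` W)"
      unfolding dim_image_eq[OF lB inj_on_subset[OF injB subset_UNIV]] W_def dimW by simp
  qed (rule sW)
  with BW sub show ?thesis by blast
qed

text \<open>The eigenspace for \<open>\<kappa>\<close> is the coordinate subspace of those i other
  than m with \<open>d i = \<kappa>\<close>. Its dimension is the multiplicity of
  \<open>\<kappa>\<close> among the d i, and a multiset is determined by its counts, which settles
  the \<open>THE\<close>.\<close>

lemma principal_curvatures_diag:
  fixes d :: "'n::finite \<Rightarrow> real"
  assumes T: "tangent_space M p = {X. X $ m = 0}"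
    and A: "\<And>X. X $ m = 0 \<Longrightarrow> shape_operator F M \<nu> p X = (\<chi> i. d i * X $ i)"
  shows "principal_curvatures F M \<nu> p = image_mset d (mset_set (UNIV - {m}))"
proof -
  have dim: "dim {X \<in> tangent_space M p. shape_operator F M \<nu> p X = \<kappa> *\<^sub>R X}
      = count (image_mset d (mset_set (UNIV - {m}))) \<kappa>" for \<kappa>
  proof -
    let ?S = "{i \<in> UNIV - {m}. d i = \<kappa>}"
    have "{X \<in> tangent_space M p. shape_operator F M \<nu> p X = \<kappa> *\<^sub>R X}
        = {X. X $ m = 0 \<and> (\<forall>i. d i * X $ i = \<kappa> * X $ i)}"
      by (auto simp: T A vec_eq_iff)
    also have "\<dots> = {X. \<forall>i. i \<notin> ?S \<longrightarrow> X $ i = 0}" by auto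
    finally show ?thesis
      using dim_substandard_cart[of ?S, where 'a = real]
      by (simp add: dim_vec_eq count_image_mset' Int_def vimage_def conj_commute eq_commute[of \<kappa>])
  qed
  show ?thesis unfolding principal_curvatures_def dim
    by (rule the_equality) (auto intro: multiset_eqI)
qed

text \<open>A parallel hypersurface need not contain segments in a tangent direction e, so the
  derivative within S is evaluated along points that approach x only asymptotically in direction
  e.\<close>

lemma has_derivative_sequence:
  fixes f :: "'a::real_normed_vector \<Rightarrow> 'b::real_normed_vector"
  assumes D: "(f has_derivative D) (at x within S)"
    and X: "\<And>n. X n \<in> S" "\<And>n. c n \<noteq> 0" "c \<longlonglongrightarrow> 0"
    and lim: "(\<lambda>n. (X n - x) /\<^sub>R c n) \<longlonglongrightarrow> e"
  shows "(\<lambda>n. (f (X n) - f x) /\<^sub>R c n) \<longlonglongrightarrow> D e"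
proof -
  have bl: "bounded_linear D" using D by (rule has_derivative_bounded_linear)
  obtain r where r: "\<And>y. y \<in> S \<Longrightarrow> f y - f x = D (y - x) + norm (y - x) *\<^sub>R r y"
    and r0: "(r \<longlongrightarrow> 0) (at x within S)" and rx: "r x = 0"
  proof
    let ?r = "\<lambda>y. (f y - f x - D (y - x)) /\<^sub>R norm (y - x)"
    show "f y - f x = D (y - x) + norm (y - x) *\<^sub>R ?r y" for y
      by (cases "y = x") (simp_all add: bounded_linear.linear[OF bl, THEN linear_0])
    show "(?r \<longlongrightarrow> 0) (at x within S)"
      using D by (simp add: has_derivative_within inverse_eq_divide diff_diff_eq)
  qed simp
  have "(\<lambda>n. c n *\<^sub>R ((X n - x) /\<^sub>R c n)) \<longlonglongrightarrow> 0 *\<^sub>R e"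
    by (intro tendsto_intros X lim)
  then have "(\<lambda>n. (X n - x) + x) \<longlonglongrightarrow> 0 + x" by (intro tendsto_intros) (simp add: X)
  then have Xx: "X \<longlonglongrightarrow> x" by simp
  have rX: "(\<lambda>n. r (X n)) \<longlonglongrightarrow> 0"
  proof (rule tendstoI)
    fix \<epsilon> :: real assume "\<epsilon> > 0"
    then have "eventually (\<lambda>y. y \<in> S \<longrightarrow> dist (r y) 0 < \<epsilon>) (nhds x)"
      using tendstoD[OF r0 \<open>\<epsilon> > 0\<close>] rx by (auto simp: eventually_at_filter elim!: eventually_mono)
    then show "eventually (\<lambda>n. dist (r (X n)) 0 < \<epsilon>) sequentially"
      using Xx X by (auto simp: filterlim_iff elim!: allE eventually_mono)
  qed
  \<comment> \<open>The remainder carries \<open>norm (X n - x)\<close>, which is the norm of the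
    difference quotient times the absolute value of \<open>c n\<close>; dividing by
    \<open>c n\<close> leaves its sign, and this factor stays bounded.\<close>
  have "(\<lambda>n. D ((X n - x) /\<^sub>R c n) + (sgn (c n) * norm ((X n - x) /\<^sub>R c n)) *\<^sub>R r (X n)) \<longlonglongrightarrow> D e + 0"
  proof (intro tendsto_add bounded_linear.tendsto[OF bl] lim)
    have "(\<lambda>n. norm (norm ((X n - x) /\<^sub>R c n) *\<^sub>R r (X n))) \<longlonglongrightarrow> norm (norm e *\<^sub>R (0::'b))"
      by (intro tendsto_intros lim rX)
    then have "(\<lambda>n. norm ((sgn (c n) * norm ((X n - x) /\<^sub>R c n)) *\<^sub>R r (X n))) \<longlonglongrightarrow> 0"
      by (simp add: abs_mult X abs_sgn_eq)
    then show "(\<lambda>n. (sgn (c n) * norm ((X n - x) /\<^sub>R c n)) *\<^sub>R r (X n)) \<longlonglongrightarrow> 0"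
      by (rule tendsto_norm_zero_cancel)
  qed
  moreover have "D ((X n - x) /\<^sub>R c n) + (sgn (c n) * norm ((X n - x) /\<^sub>R c n)) *\<^sub>R r (X n)
      = (f (X n) - f x) /\<^sub>R c n" for n
  proof -
    have "sgn (c n) * \<bar>inverse (c n)\<bar> = inverse (c n)"
      using X(2)[of n] by (simp add: sgn_if field_simps abs_if)
    then show ?thesis
      unfolding r[OF X(1)] linear_scale[OF bounded_linear.linear[OF bl]]
      by (simp add: scaleR_add_right mult.assoc[symmetric])
  qed
  ultimately show ?thesis by simp
qed

section \<open>The fundamental tensor and the spray of the conformal Randers metric\<close>

lemma matrix_inv_eqI:
  fixes A B :: "real^'n::finite^'n"
  assumes "A ** B = mat 1"
  shows "matrix_inv A = B"
proof -
  have BA: "B ** A = mat 1" using assms matrix_left_right_inverse by blast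
  then have "matrix_inv A ** A = mat 1" "A ** matrix_inv A = mat 1"
    using someI[of "\<lambda>A'. A ** A' = mat 1 \<and> A' ** A = mat 1" B] assms
    by (auto simp: matrix_inv_def)
  then show ?thesis
    by (metis BA matrix_mul_assoc matrix_mul_lid matrix_mul_rid)
qed

section \<open>The Randers norm: Zermelo form, gradient and Hessian\<close>

locale randers_conformal =
  fixes b lam x0 :: real
    and m :: "'n::finite"
    and F :: "real^'n \<Rightarrow> real"
    and \<rho> :: "real^'n \<Rightarrow> real"
    and Ft :: "real^'n \<Rightarrow> real^'n \<Rightarrow> real"
    and M :: "(real^'n) set"
    and nt :: "real^'n \<Rightarrow> real^'n"
  assumes b0: "0 \<le> b" and b1: "b < 1" and lam: "lam = 1 - b\<^sup>2"
    and F_eq: "F = (\<lambda>y. (sqrt (lam * (\<Sum>i\<in>UNIV. (y $ i)\<^sup>2) + b\<^sup>2 * (y $ m)\<^sup>2) - b * y $ m) / lam)"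
    and \<rho>_eq: "\<rho> = (\<lambda>x. \<Sum>a\<in>UNIV - {m}. ln (2 + cos (pi * x $ a)))"
    and Ft_eq: "Ft = (\<lambda>x y. exp (\<rho> x) * F y)"
    and M_eq: "M = {x. x $ m = x0}"
    and nt_eq: "nt = (\<lambda>x. ((1 + b) * exp (- \<rho> x)) *\<^sub>R axis m 1)"
begin

text \<open>This is the square root occurring in F (see \<open>Q_eq\<close>), written without a root
  so that identities between F and Q become polynomial.\<close>

definition Q :: "real^'n \<Rightarrow> real" where "Q y = lam * F y + b * y $ m"

abbreviation e :: "'n \<Rightarrow> real" where "e i \<equiv> axis m 1 $ i"

text \<open>The gradient of F (see \<open>F_deriv\<close>). The numerator is the Euclidean normal of
  the translated sphere, and dividing by Q produces Euler's relation, inner product of \<theta> and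
  y equal to F.\<close>

definition \<theta> :: "real^'n \<Rightarrow> real^'n" where "\<theta> y = (\<chi> i. (y $ i - b * F y * e i) / Q y)"

lemma lam_pos: "0 < lam"
proof -
  have "lam = (1 - b) * (1 + b)" by (simp add: lam power2_eq_square algebra_simps)
  with b0 b1 show ?thesis by simp
qed

lemma F_apply: "F y = (sqrt (lam * (\<Sum>i\<in>UNIV. (y $ i)\<^sup>2) + b\<^sup>2 * (y $ m)\<^sup>2) - b * y $ m) / lam"
  by (subst F_eq) (rule refl)

lemma Q_eq: "Q y = sqrt (lam * (\<Sum>i\<in>UNIV. (y $ i)\<^sup>2) + b\<^sup>2 * (y $ m)\<^sup>2)"
  unfolding Q_def F_apply using lam_pos by simp

lemma sumsq_pos: "y \<noteq> 0 \<Longrightarrow> 0 < (\<Sum>i\<in>UNIV. (y $ i)\<^sup>2)" for y :: "real^'n"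
proof -
  assume "y \<noteq> 0"
  then obtain i where "y $ i \<noteq> 0" by (auto simp: vec_eq_iff)
  then show ?thesis by (intro sum_pos2[of _ i]) auto
qed

lemma F_pos: assumes "y \<noteq> 0" shows "0 < F y"
proof -
  have "b * y $ m \<le> sqrt (b\<^sup>2 * (y $ m)\<^sup>2)"
    by (metis abs_ge_self power_mult_distrib real_sqrt_abs)
  also have "\<dots> < sqrt (lam * (\<Sum>i\<in>UNIV. (y $ i)\<^sup>2) + b\<^sup>2 * (y $ m)\<^sup>2)"
    using sumsq_pos[OF assms] lam_pos by simp
  finally show ?thesis using lam_pos by (simp add: F_eq)
qed

lemma Q_pos: assumes "y \<noteq> 0" shows "0 < Q y"
  unfolding Q_eq using sumsq_pos[OF assms] lam_pos by (simp add: add_pos_nonneg)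

lemma sum_e: "(\<Sum>i\<in>UNIV. f i * e i) = f m" for f :: "'n \<Rightarrow> real"
  by (simp add: axis_def if_distrib[of "\<lambda>t. _ * t"] cong: if_cong)

lemma sumsq_shift:
  "(\<Sum>i\<in>UNIV. (y $ i - c * e i)\<^sup>2) = (\<Sum>i\<in>UNIV. (y $ i)\<^sup>2) - 2 * c * y $ m + c\<^sup>2"
proof -
  have "(y $ i - c * e i)\<^sup>2 = (y $ i)\<^sup>2 - (2 * c * y $ i) * e i + c\<^sup>2 * e i" for i
    by (auto simp: axis_def power2_eq_square algebra_simps)
  then show ?thesis by (simp add: sum.distrib sum_subtractf sum_e)
qed

text \<open>The indicatrix of \<open>F\<close> is the Euclidean unit sphere translated by \<open>b\<close> along the
  \<open>m\<close>-th axis.\<close>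

lemma zermelo: "(\<Sum>i\<in>UNIV. (y $ i - b * F y * e i)\<^sup>2) = (F y)\<^sup>2"
proof -
  have "(Q y)\<^sup>2 = lam * (\<Sum>i\<in>UNIV. (y $ i)\<^sup>2) + b\<^sup>2 * (y $ m)\<^sup>2"
    unfolding Q_eq using lam_pos by (simp add: sum_nonneg)
  then have "lam * (\<Sum>i\<in>UNIV. (y $ i)\<^sup>2) = lam * (lam * (F y)\<^sup>2 + 2 * b * F y * y $ m)"
    by (simp add: Q_def power2_eq_square algebra_simps)
  then have *: "(\<Sum>i\<in>UNIV. (y $ i)\<^sup>2) = lam * (F y)\<^sup>2 + 2 * b * F y * y $ m"
    using lam_pos by simp
  show ?thesis unfolding sumsq_shift * by (simp add: lam power2_eq_square algebra_simps)
qed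

text \<open>Converse of \<open>zermelo\<close>: the equation is quadratic in f, and the sign of
  \<open>lam * f + b * y $ m\<close> selects the root with a plus sign. It serves to read off F on
  vectors given as a Euclidean part plus drift.\<close>

lemma F_unique:
  assumes f: "0 \<le> f" and eq: "(\<Sum>i\<in>UNIV. (y $ i - b * f * e i)\<^sup>2) = f\<^sup>2" and Q: "0 \<le> lam * f + b * y $ m"
  shows "F y = f"
proof -
  have *: "(\<Sum>i\<in>UNIV. (y $ i)\<^sup>2) = lam * f\<^sup>2 + 2 * b * f * y $ m"
    using eq unfolding sumsq_shift by (simp add: lam power2_eq_square algebra_simps)
  have "lam * (\<Sum>i\<in>UNIV. (y $ i)\<^sup>2) + b\<^sup>2 * (y $ m)\<^sup>2 = (lam * f + b * y $ m)\<^sup>2"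
    unfolding * by (simp add: power2_eq_square algebra_simps)
  then have "Q y = lam * f + b * y $ m"
    unfolding Q_eq using Q by simp
  then show ?thesis using lam_pos by (simp add: Q_def)
qed

lemma F_axis: assumes "0 \<le> c" shows "F (c *\<^sub>R axis m 1) = c / (1 + b)"
proof (rule F_unique)
  show "0 \<le> c / (1 + b)" using assms b0 by simp
  have "(c *\<^sub>R axis m 1) $ i - b * (c / (1 + b)) * e i = (c / (1 + b)) * e i" for i
    using b0 by (simp add: field_simps)
  then show "(\<Sum>i\<in>UNIV. ((c *\<^sub>R axis m 1) $ i - b * (c / (1 + b)) * e i)\<^sup>2) = (c / (1 + b))\<^sup>2"
    using sum_e[of "\<lambda>_. (c / (1 + b))\<^sup>2"]
    by (simp only: power_mult_distrib) (simp add: axis_def if_distrib[of "\<lambda>t. t\<^sup>2"] cong: if_cong)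
  show "0 \<le> lam * (c / (1 + b)) + b * (c *\<^sub>R axis m 1) $ m"
    using assms b0 lam_pos by simp
qed

lemma F_deriv:
  assumes y: "y \<noteq> 0"
  shows "(F has_derivative (\<lambda>h. \<theta> y \<bullet> h)) (at y)"
proof -
  let ?s = "\<lambda>y::real^'n. lam * (\<Sum>i\<in>UNIV. (y $ i)\<^sup>2) + b\<^sup>2 * (y $ m)\<^sup>2"
  have s: "?s y > 0" using sumsq_pos[OF y] lam_pos by (simp add: add_pos_nonneg)
  have "(?s has_derivative (\<lambda>h. lam * (\<Sum>i\<in>UNIV. 2 * y $ i * h $ i) + b\<^sup>2 * (2 * y $ m * h $ m))) (at y)"
    by (auto intro!: derivative_eq_intros bounded_linear_imp_has_derivative bounded_linear_vec_nth simp: algebra_simps)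
  then have *: "((\<lambda>y. sqrt (?s y)) has_derivative
      (\<lambda>h. (lam * (\<Sum>i\<in>UNIV. 2 * y $ i * h $ i) + b\<^sup>2 * (2 * y $ m * h $ m)) * (inverse (sqrt (?s y)) / 2))) (at y)"
    by (rule has_derivative_real_sqrt[of ?s, OF s])
  have "(F has_derivative (\<lambda>h. ((lam * (\<Sum>i\<in>UNIV. 2 * y $ i * h $ i) + b\<^sup>2 * (2 * y $ m * h $ m)) * (inverse (Q y) / 2) - b * h $ m) / lam)) (at y)"
  proof -
    have bm: "((\<lambda>y::real^'n. b * y $ m) has_derivative (\<lambda>h. b * h $ m)) (at y)"
      by (intro has_derivative_mult_right bounded_linear_imp_has_derivative bounded_linear_vec_nth)
    have "((\<lambda>y. inverse lam * (sqrt (?s y) - b * y $ m)) has_derivative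
      (\<lambda>h. inverse lam * ((lam * (\<Sum>i\<in>UNIV. 2 * y $ i * h $ i) + b\<^sup>2 * (2 * y $ m * h $ m)) * (inverse (sqrt (?s y)) / 2) - b * h $ m))) (at y)"
      by (rule has_derivative_mult_right[OF has_derivative_diff[OF * bm]])
    moreover have "F = (\<lambda>y. inverse lam * (sqrt (?s y) - b * y $ m))"
      unfolding fun_eq_iff F_apply by (simp only: divide_inverse mult.commute)  simp
    ultimately show ?thesis
      unfolding Q_eq by (simp only: divide_inverse mult.commute[of _ "inverse lam"])
  qed
  moreover have "((lam * (\<Sum>i\<in>UNIV. 2 * y $ i * h $ i) + b\<^sup>2 * (2 * y $ m * h $ m)) * (inverse (Q y) / 2) - b * h $ m) / lam = \<theta> y \<bullet> h" for h
  proof -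
    have "\<theta> y \<bullet> h = (\<Sum>i\<in>UNIV. (y $ i * h $ i - (b * F y * h $ i) * e i) / Q y)"
      by (simp add: inner_vec_def \<theta>_def algebra_simps)
    also have "\<dots> = ((\<Sum>i\<in>UNIV. y $ i * h $ i) - b * F y * h $ m) / Q y"
      by (simp only: sum_divide_distrib[symmetric] sum_subtractf sum_e)
    finally have 1: "\<theta> y \<bullet> h = ((\<Sum>i\<in>UNIV. y $ i * h $ i) - b * F y * h $ m) / Q y" .
    have 2: "(\<Sum>i\<in>UNIV. 2 * y $ i * h $ i) = 2 * (\<Sum>i\<in>UNIV. y $ i * h $ i)"
      by (simp add: sum_distrib_left mult.assoc)
    have nz: "Q y \<noteq> 0" "lam \<noteq> 0" using Q_pos[OF y] lam_pos by auto
    define S where "S = (\<Sum>i\<in>UNIV. y $ i * h $ i)"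
    have "lam * S + b\<^sup>2 * y $ m * h $ m - b * h $ m * Q y = lam * (S - b * F y * h $ m)"
      by (simp add: Q_def power2_eq_square algebra_simps)
    moreover have "((lam * (2 * S) + b\<^sup>2 * (2 * y $ m * h $ m)) * (inverse (Q y) / 2) - b * h $ m) / lam
      = (lam * S + b\<^sup>2 * y $ m * h $ m - b * h $ m * Q y) / (lam * Q y)"
      using nz by (simp add: divide_simps)
    ultimately show ?thesis unfolding 1 2 S_def[symmetric] using nz by simp
  qed
  ultimately show ?thesis by simp
qed

lemma F_DERIV_axis:
  assumes "y \<noteq> 0"
  shows "((\<lambda>t. F (y + t *\<^sub>R axis i 1)) has_real_derivative \<theta> y $ i) (at 0)"
proof -
  have "((\<lambda>t. y + t *\<^sub>R axis i 1) has_derivative (\<lambda>t. t *\<^sub>R axis i 1)) (at 0)"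
    by (auto intro!: derivative_eq_intros)
  from has_derivative_compose[OF this, of F "\<lambda>h. \<theta> y \<bullet> h"] show ?thesis
    using F_deriv[OF assms] by (simp add: has_field_derivative_def inner_axis mult_commute_abs)
qed

lemma partial_Ft2:
  assumes "y \<noteq> 0"
  shows "partial i (\<lambda>v. (Ft x v)\<^sup>2) y = exp (2 * \<rho> x) * (2 * F y * \<theta> y $ i)"
proof (rule partial_eqI)
  have "exp (2 * \<rho> x) = (exp (\<rho> x))\<^sup>2" by (rule exp_double)
  then show "((\<lambda>t. (Ft x (y + t *\<^sub>R axis i 1))\<^sup>2) has_real_derivative
      exp (2 * \<rho> x) * (2 * F y * \<theta> y $ i)) (at 0)"
    unfolding Ft_eq
    by (auto intro!: derivative_eq_intros F_DERIV_axis[OF assms] simp: power2_eq_square)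
qed

lemma nonzero_near:
  fixes y :: "real^'n"
  assumes "y \<noteq> 0"
  shows "eventually (\<lambda>t. y + t *\<^sub>R axis i 1 \<noteq> 0) (nhds (0::real))"
proof -
  have "open ((\<lambda>t::real. y + t *\<^sub>R axis i 1) -` (- {0}))"
    by (intro open_vimage continuous_intros open_Compl closed_singleton)
  then have "open {t::real. y + t *\<^sub>R axis i 1 \<noteq> 0}" by (simp add: vimage_def)
  then show ?thesis using assms by (auto simp: eventually_nhds intro!: exI[of _ "{t::real. y + t *\<^sub>R axis i 1 \<noteq> 0}"])
qed

text \<open>The Hessian of F. The quotient rule stays short because the numerator of \<theta> equals
  \<theta> times Q, and Q has gradient \<open>lam\<close> times \<theta> plus b times
  \<open>axis m 1\<close>.\<close>

lemma \<theta>_DERIV: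
  assumes y: "y \<noteq> 0"
  shows "((\<lambda>t. \<theta> (y + t *\<^sub>R axis j 1) $ i) has_real_derivative
    (axis j 1 $ i - b * (\<theta> y $ j * e i + e j * \<theta> y $ i) - lam * \<theta> y $ i * \<theta> y $ j) / Q y) (at 0)"
proof -
  have Q: "Q y \<noteq> 0" using Q_pos[OF y] by simp
  have ji: "axis j 1 $ m = e j" by (simp add: axis_def)
  have dQ: "((\<lambda>t. Q (y + t *\<^sub>R axis j 1)) has_real_derivative lam * \<theta> y $ j + b * e j) (at 0)"
    unfolding Q_def by (auto intro!: derivative_eq_intros F_DERIV_axis[OF y] simp: ji)
  have dn: "((\<lambda>t. (y + t *\<^sub>R axis j 1) $ i - b * F (y + t *\<^sub>R axis j 1) * e i) has_real_derivative
      axis j 1 $ i - b * \<theta> y $ j * e i) (at 0)"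
    by (auto intro!: derivative_eq_intros F_DERIV_axis[OF y])
  have n: "y $ i - b * F y * e i = \<theta> y $ i * Q y" using Q by (simp add: \<theta>_def)
  have "((\<lambda>t. ((y + t *\<^sub>R axis j 1) $ i - b * F (y + t *\<^sub>R axis j 1) * e i) / Q (y + t *\<^sub>R axis j 1))
      has_real_derivative
      ((axis j 1 $ i - b * \<theta> y $ j * e i) * Q y - \<theta> y $ i * Q y * (lam * \<theta> y $ j + b * e j)) / (Q y * Q y)) (at 0)"
    using DERIV_divide[OF dn dQ] Q n by simp
  moreover have "(axis j 1 $ i - b * \<theta> y $ j * e i) * Q y - \<theta> y $ i * Q y * (lam * \<theta> y $ j + b * e j)
      = (axis j 1 $ i - b * (\<theta> y $ j * e i + e j * \<theta> y $ i) - lam * \<theta> y $ i * \<theta> y $ j) * Q y"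
    by (simp add: algebra_simps)
  ultimately show ?thesis using Q unfolding \<theta>_def vec_lambda_beta by simp
qed

lemma fundamental_tensor_Ft:
  assumes y: "y \<noteq> 0"
  shows "fundamental_tensor Ft x y $ i $ j = exp (2 * \<rho> x) * (\<theta> y $ i * \<theta> y $ j
    + F y / Q y * (axis j 1 $ i - b * (\<theta> y $ j * e i + e j * \<theta> y $ i) - lam * \<theta> y $ i * \<theta> y $ j))"
proof -
  have "partial j (partial i (\<lambda>v. (Ft x v)\<^sup>2)) y = partial j (\<lambda>v. exp (2 * \<rho> x) * (2 * F v * \<theta> v $ i)) y"
    by (rule partial_cong_ev) (use nonzero_near[OF y, of j] in \<open>auto elim!: eventually_mono simp: partial_Ft2\<close>)
  also have "\<dots> = exp (2 * \<rho> x) * (2 * (\<theta> y $ j * \<theta> y $ i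
      + (axis j 1 $ i - b * (\<theta> y $ j * e i + e j * \<theta> y $ i) - lam * \<theta> y $ i * \<theta> y $ j) / Q y * F y))"
    using DERIV_cmult[OF DERIV_cmult[OF DERIV_mult[OF F_DERIV_axis[OF y] \<theta>_DERIV[OF y]]],
        of "exp (2 * \<rho> x)" 2 j j i]
    by (intro partial_eqI) (simp add: mult.assoc)
  finally show ?thesis by (simp add: fundamental_tensor_def)
qed


section \<open>The inverse of the fundamental tensor\<close>

text \<open>The vector y with its drift removed, of Euclidean length \<open>F y\<close> by
  \<open>zermelo\<close>; \<theta> is a multiple of it.\<close>

definition w :: "real^'n \<Rightarrow> real^'n" where "w y = y - (b * F y) *\<^sub>R axis m 1"

lemma w_nth: "w y $ i = y $ i - b * F y * e i"
  by (simp add: w_def)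

lemma \<theta>_eq: "\<theta> y = w y /\<^sub>R Q y"
  by (simp add: \<theta>_def vec_eq_iff w_nth divide_inverse_commute)

lemma w_inner_w: "w y \<bullet> w y = (F y)\<^sup>2"
  using zermelo[of y] by (simp add: inner_vec_def w_nth power2_eq_square)

lemma Q_eq_w: "Q y = F y + b * w y $ m"
  unfolding Q_def w_nth by (simp add: lam power2_eq_square algebra_simps)

lemma w_inner_y: "w y \<bullet> y = F y * Q y"
proof -
  have "w y \<bullet> y = w y \<bullet> (w y + (b * F y) *\<^sub>R axis m 1)" by (simp add: w_def)
  also have "\<dots> = (F y)\<^sup>2 + b * F y * w y $ m" by (simp add: inner_add_right w_inner_w inner_axis)
  finally show ?thesis by (simp add: Q_eq_w power2_eq_square algebra_simps)
qed

text \<open>Inverse of the fundamental tensor of F, found by splitting: the tensor sends y to F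
  \<theta>, and on vectors X orthogonal to w it is F/Q times X up to a multiple of \<theta>. Hence
  the inverse is Q/F times the Euclidean projection along w, plus the rank one term that sends
  \<theta> to y/F.\<close>

definition ginv :: "real^'n \<Rightarrow> real^'n^'n" where
  "ginv y = (\<chi> i l. Q y / F y * (axis l 1 $ i - w y $ i * w y $ l / (F y)\<^sup>2) + y $ i * y $ l / (F y)\<^sup>2)"

lemma sum_axis: "(\<Sum>l\<in>UNIV. axis l 1 $ i * c l) = c i" for c :: "'n \<Rightarrow> real"
  by (simp add: axis_def if_distrib[of "\<lambda>t. t * _"] cong: if_cong)

lemma ginv_sum:
  "(\<Sum>l\<in>UNIV. ginv y $ i $ l * c $ l) =
    Q y / F y * (c $ i - w y $ i * (w y \<bullet> c) / (F y)\<^sup>2) + y $ i * (y \<bullet> c) / (F y)\<^sup>2"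
proof -
  have *: "ginv y $ i $ l * c $ l = Q y / F y * (axis l 1 $ i * c $ l)
      - Q y / F y * w y $ i / (F y)\<^sup>2 * (w y $ l * c $ l) + y $ i / (F y)\<^sup>2 * (y $ l * c $ l)" for l
    by (simp add: ginv_def algebra_simps)
  have "(\<Sum>l\<in>UNIV. ginv y $ i $ l * c $ l) = Q y / F y * c $ i
      - Q y / F y * w y $ i / (F y)\<^sup>2 * (w y \<bullet> c) + y $ i / (F y)\<^sup>2 * (y \<bullet> c)"
    unfolding * sum.distrib sum_subtractf sum_distrib_left[symmetric] sum_axis inner_vec_def by simp
  also have "\<dots> = Q y / F y * (c $ i - w y $ i * (w y \<bullet> c) / (F y)\<^sup>2) + y $ i * (y \<bullet> c) / (F y)\<^sup>2"
    by (simp add: right_diff_distrib)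
  finally show ?thesis .
qed

lemma ginv_sym: "ginv y $ i $ j = ginv y $ j $ i"
  by (simp add: ginv_def axis_def algebra_simps)

lemma fundamental_tensor_inverse:
  assumes y: "y \<noteq> 0"
  shows "matrix_inv (fundamental_tensor Ft x y) = (\<chi> i j. exp (- 2 * \<rho> x) * ginv y $ i $ j)"
proof (rule matrix_inv_eqI)
  note pos = F_pos[OF y] Q_pos[OF y]
  have "(\<Sum>j\<in>UNIV. fundamental_tensor Ft x y $ i $ j * (exp (- 2 * \<rho> x) * ginv y $ j $ l)) = mat 1 $ i $ l" for i l
  proof -
    define f q A B C N K where "f = F y" and "q = Q y" and "A = e i" and "B = e l"
      and "C = w y $ i" and "N = w y $ l" and "K = C / q - f / q * (b * A + lam * (C / q))"
    note defs = f_def q_def A_def B_def C_def N_def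
    \<comment> \<open>Row i of the tensor without its exponential factor, as a combination of
      \<theta> and two coordinate vectors. By \<open>ginv_sum\<close> only its inner products with w
      and y are then required.\<close>
    define c where "c = K *\<^sub>R \<theta> y + (f / q) *\<^sub>R axis i 1 - (f / q * b * (C / q)) *\<^sub>R axis m 1"
    have pos': "f \<noteq> 0" "q \<noteq> 0" using pos by (simp_all add: f_def q_def)
    have th: "\<theta> y $ i = C / q" "\<theta> y $ l = N / q"
      by (simp_all add: \<theta>_eq defs divide_inverse_commute)
    have c: "fundamental_tensor Ft x y $ i $ j = exp (2 * \<rho> x) * c $ j" for j
      unfolding fundamental_tensor_Ft[OF y] c_def K_def defs(1-3)[symmetric] th
      by (simp add: algebra_simps axis_def)
    have q: "q = f + b * w y $ m" "q = lam * f + b * y $ m"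
      by (simp_all only: q_def f_def Q_eq_w[symmetric] Q_def[symmetric])
    have yl: "y $ i = C + b * f * A" "y $ l = N + b * f * B"
      by (simp_all add: defs w_nth)
    have w\<theta>: "w y \<bullet> \<theta> y = f\<^sup>2 / q" "y \<bullet> \<theta> y = f"
      using pos by (simp_all add: \<theta>_eq w_inner_w inner_commute[of y] w_inner_y divide_inverse_commute f_def q_def)
    have "w y \<bullet> c = K * (f\<^sup>2 / q) + f / q * C - f / q * b * (C / q) * w y $ m"
      unfolding c_def by (simp add: inner_add_right inner_diff_right w\<theta> inner_axis C_def)
    moreover have "f / q * C - f / q * b * (C / q) * w y $ m = f * C * (q - b * w y $ m) / q\<^sup>2"
      using pos' by (simp add: field_simps power2_eq_square)
    moreover have "q - b * w y $ m = f" using q(1) by simp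
    ultimately have wc: "w y \<bullet> c = K * f\<^sup>2 / q + f\<^sup>2 * C / q\<^sup>2"
      by (simp add: power2_eq_square)
    have "y \<bullet> c = K * f + f / q * (C + b * f * A) - f / q * b * (C / q) * y $ m"
      unfolding c_def by (simp add: inner_add_right inner_diff_right w\<theta> inner_axis yl)
    also have "\<dots> = f * C * (2 * q - (lam * f + b * y $ m)) / q\<^sup>2"
      unfolding K_def using pos' by (simp add: field_simps power2_eq_square)
    also have "\<dots> = f * C / q"
      unfolding q(2)[symmetric] using pos' by (simp add: power2_eq_square)
    finally have yc: "y \<bullet> c = f * C / q" .
    have cl: "c $ l = K * (N / q) + f / q * axis i 1 $ l - f / q * b * (C / q) * B"
      unfolding c_def by (simp add: th B_def)
    have "(\<Sum>j\<in>UNIV. fundamental_tensor Ft x y $ i $ j * (exp (- 2 * \<rho> x) * ginv y $ j $ l))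
      = (\<Sum>j\<in>UNIV. ginv y $ l $ j * c $ j)"
      by (rule sum.cong) (simp_all add: c ginv_sym[of y l] exp_minus field_simps)
    also have "\<dots> = q / f * (c $ l - N * (w y \<bullet> c) / f\<^sup>2) + y $ l * (y \<bullet> c) / f\<^sup>2"
      unfolding ginv_sum defs ..
    also have "\<dots> = axis i 1 $ l"
      unfolding wc yc cl yl using pos' by (simp add: field_simps power2_eq_square)
    finally show ?thesis by (simp add: mat_def axis_def)
  qed
  then show "fundamental_tensor Ft x y ** (\<chi> i j. exp (- 2 * \<rho> x) * ginv y $ i $ j) = mat 1"
    by (simp add: matrix_matrix_mult_def vec_eq_iff)
qed

section \<open>Spray, nonlinear connection and S-curvature\<close>

text \<open>The gradient of \<rho> (see \<open>\<rho>_deriv\<close>).\<close>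

definition r :: "real^'n \<Rightarrow> real^'n" where
  "r x = (\<chi> k. if k = m then 0 else - pi * sin (pi * x $ k) / (2 + cos (pi * x $ k)))"

lemma r_m [simp]: "r x $ m = 0"
  by (simp add: r_def)

lemma two_cos_pos: "0 < 2 + cos (t::real)"
  using cos_ge_minus_one[of t] by linarith

lemma \<rho>_deriv: "(\<rho> has_derivative (\<lambda>h. r x \<bullet> h)) (at x)"
proof -
  have "((\<lambda>x. \<Sum>a\<in>UNIV - {m}. ln (2 + cos (pi * x $ a))) has_derivative
      (\<lambda>h. \<Sum>a\<in>UNIV - {m}. (- pi * sin (pi * x $ a) / (2 + cos (pi * x $ a))) * h $ a)) (at x)"
  proof (rule has_derivative_sum)
    fix a
    show "((\<lambda>x::real^'n. ln (2 + cos (pi * x $ a))) has_derivative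
      (\<lambda>h. (- pi * sin (pi * x $ a) / (2 + cos (pi * x $ a))) * h $ a)) (at x)"
      by (rule has_derivative_coord[where \<phi> = "\<lambda>t. ln (2 + cos (pi * t))"])
        (use two_cos_pos[of "pi * x $ a"] in \<open>auto intro!: derivative_eq_intros simp: field_simps\<close>)
  qed
  moreover have "(\<Sum>a\<in>UNIV - {m}. (- pi * sin (pi * x $ a) / (2 + cos (pi * x $ a))) * h $ a) = r x \<bullet> h" for h
    unfolding inner_vec_def by (rule sum.mono_neutral_cong_left) (auto simp: r_def)
  ultimately show ?thesis by (simp add: \<rho>_eq)
qed

lemma \<rho>_DERIV: "((\<lambda>t. \<rho> (x + t *\<^sub>R axis k 1)) has_real_derivative r x $ k) (at 0)"
proof -
  have "((\<lambda>t. x + t *\<^sub>R axis k 1) has_derivative (\<lambda>t. t *\<^sub>R axis k 1)) (at 0)"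
    by (auto intro!: derivative_eq_intros)
  from has_derivative_compose[OF this, of \<rho> "\<lambda>h. r x \<bullet> h"] show ?thesis
    using \<rho>_deriv[of x] by (simp add: has_field_derivative_def inner_axis mult_commute_abs)
qed

text \<open>F does not depend on x, so every x-derivative falls on the conformal factor and yields
  r. Raising the index sends \<theta> to y/F, and the exponentials cancel.\<close>

lemma geodesic_coeff_Ft:
  assumes y: "y \<noteq> 0"
  shows "geodesic_coeff Ft x y $ i =
    ((r x \<bullet> y) * y $ i - F y * Q y * r x $ i + Q y / F y * (r x \<bullet> y) * w y $ i) / 2"
proof -
  note pos = F_pos[OF y] Q_pos[OF y]
  let ?E = "exp (2 * \<rho> x)"
  have 1: "partial k (\<lambda>z. partial l (\<lambda>v. (Ft z v)\<^sup>2) y) x = ?E * (4 * F y * \<theta> y $ l) * r x $ k" for k l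
    unfolding partial_Ft2[OF y]
    by (rule partial_eqI) (auto intro!: derivative_eq_intros \<rho>_DERIV)
  have E: "(Ft z y)\<^sup>2 = exp (2 * \<rho> z) * (F y)\<^sup>2" for z
    by (simp add: Ft_eq exp_double power_mult_distrib)
  have 2: "partial l (\<lambda>z. (Ft z y)\<^sup>2) x = ?E * (2 * (F y)\<^sup>2) * r x $ l" for l
    unfolding E by (rule partial_eqI) (auto intro!: derivative_eq_intros \<rho>_DERIV)
  have 3: "(\<Sum>k\<in>UNIV. ?E * (4 * F y * \<theta> y $ l) * r x $ k * y $ k) = ?E * (4 * F y * \<theta> y $ l) * (r x \<bullet> y)" for l
    by (simp add: inner_vec_def sum_distrib_left mult.assoc)
  have "geodesic_coeff Ft x y $ i = 1/4 * (\<Sum>l\<in>UNIV. exp (- 2 * \<rho> x) * ginv y $ i $ l *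
     (?E * (4 * F y * \<theta> y $ l) * (r x \<bullet> y) - ?E * (2 * (F y)\<^sup>2) * r x $ l))"
    by (simp add: geodesic_coeff_def fundamental_tensor_inverse[OF y] 1 2 3)
  also have "\<dots> = 1/4 * (\<Sum>l\<in>UNIV. ginv y $ i $ l *
     ((4 * F y * (r x \<bullet> y)) *\<^sub>R \<theta> y - (2 * (F y)\<^sup>2) *\<^sub>R r x) $ l)"
    by (rule arg_cong, rule sum.cong) (simp_all add: exp_minus field_simps)
  also have "\<dots> = ((r x \<bullet> y) * y $ i - F y * Q y * r x $ i + Q y / F y * (r x \<bullet> y) * w y $ i) / 2"
  proof -
    \<comment> \<open>w and y differ along \<open>axis m 1\<close>, where r has no
      component.\<close>
    have wr: "w y \<bullet> r x = r x \<bullet> y"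
      by (simp add: w_def inner_diff_left inner_axis' inner_commute[of "r x"])
    have w\<theta>: "w y \<bullet> \<theta> y = (F y)\<^sup>2 / Q y" "y \<bullet> \<theta> y = F y"
      using pos by (simp_all add: \<theta>_eq w_inner_w inner_commute[of y] w_inner_y divide_inverse_commute)
    have th: "\<theta> y $ i = w y $ i / Q y" by (simp add: \<theta>_eq divide_inverse_commute)
    show ?thesis
      unfolding ginv_sum using pos
      by (simp add: inner_diff_right wr w\<theta> th inner_commute[of y "r x"] field_simps power2_eq_square)
  qed
  finally show ?thesis .
qed

lemma axis_values:
  assumes c: "0 < c"
  shows "F (c *\<^sub>R axis m 1) = c / (1 + b)" "Q (c *\<^sub>R axis m 1) = c"
    "w (c *\<^sub>R axis m 1) $ i = c / (1 + b) * e i" "\<theta> (c *\<^sub>R axis m 1) $ i = e i / (1 + b)"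
proof -
  show F: "F (c *\<^sub>R axis m 1) = c / (1 + b)" using c by (simp add: F_axis)
  have b: "1 + b \<noteq> 0" using b0 by simp
  show w: "w (c *\<^sub>R axis m 1) $ i = c / (1 + b) * e i" for i
    using b by (simp add: w_nth F) (simp add: field_simps)
  show Q: "Q (c *\<^sub>R axis m 1) = c"
    using b by (simp add: Q_eq_w F w) (metis add_divide_distrib distrib_left mult.commute mult.right_neutral nonzero_mult_div_cancel_right times_divide_eq_right)
  show "\<theta> (c *\<^sub>R axis m 1) $ i = e i / (1 + b)"
    using b c by (simp add: \<theta>_eq Q w) 
qed

lemma finsler_inner_axis:
  assumes c: "0 < c"
  shows "finsler_inner Ft x (c *\<^sub>R axis m 1) (c *\<^sub>R axis m 1) X = exp (2 * \<rho> x) * c / (1 + b)\<^sup>2 * X $ m"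
proof -
  have y: "c *\<^sub>R axis m (1::real) \<noteq> 0" using c by simp
  have b: "1 + b \<noteq> 0" using b0 by simp
  \<comment> \<open>The second summand is the Hessian of F on \<open>axis m 1\<close> itself; it
    vanishes because F is homogeneous of degree one along the ray.\<close>
  have K: "1 / (1 + b)\<^sup>2 + (1 - b * (2 / (1 + b)) - lam / (1 + b)\<^sup>2) / (1 + b) = 1 / (1 + b)\<^sup>2"
  proof -
    have "lam = (1 - b) * (1 + b)" by (simp add: lam power2_eq_square algebra_simps)
    then have "lam / (1 + b)\<^sup>2 = (1 - b) / (1 + b)" using b by (simp add: power2_eq_square)
    then show ?thesis using b by (simp add: field_simps)
  qed
  have g: "fundamental_tensor Ft x (c *\<^sub>R axis m 1) $ i $ j * (c *\<^sub>R axis m 1) $ i * X $ j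
      = (exp (2 * \<rho> x) * c / (1 + b)\<^sup>2 * X $ j * e j) * e i" for i j
  proof (cases "i = m")
    case True
    have "fundamental_tensor Ft x (c *\<^sub>R axis m 1) $ m $ j = exp (2 * \<rho> x) *
       (1 / (1 + b)\<^sup>2 + (1 - b * (2 / (1 + b)) - lam / (1 + b)\<^sup>2) / (1 + b)) * e j"
      unfolding fundamental_tensor_Ft[OF y] axis_values[OF c]
      using c b by (cases "j = m") (auto simp: axis_def power2_eq_square)
    then show ?thesis unfolding K using True by simp
  qed (simp add: axis_def)
  show ?thesis
    by (simp only: finsler_inner_def g sum_distrib_right[symmetric] sum_e)
qed

text \<open>At multiples of \<open>axis m 1\<close> the component of \<theta> along any other axis
  vanishes, so F and Q are stationary in these directions. As r is orthogonal to
  \<open>axis m 1\<close>, only the terms in which the factor \<open>r x \<bullet> v\<close> is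
  differentiated survive.\<close>

lemma nonlinear_connection_axis:
  assumes c: "0 < c" and X: "X $ m = 0"
  shows "nonlinear_connection Ft x (c *\<^sub>R axis m 1) *v X = (c * (r x \<bullet> X)) *\<^sub>R axis m 1"
proof -
  let ?y = "c *\<^sub>R axis m (1::real) :: real^'n"
  have y: "?y \<noteq> 0" using c by simp
  have b: "1 + b \<noteq> 0" using b0 by simp
  have N: "nonlinear_connection Ft x ?y $ i $ j = c * r x $ j * e i" if j: "j \<noteq> m" for i j
  proof -
    have th: "\<theta> ?y $ j = 0" using j axis_values(4)[OF c, of j] by (simp add: axis_def)
    have jm: "axis j 1 $ m = (0::real)" "e j = 0" using j by (simp_all add: axis_def)
    have Fd: "((\<lambda>t. F (?y + t *\<^sub>R axis j 1)) has_real_derivative 0) (at 0)"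
      using F_DERIV_axis[OF y, of j] th by simp
    have Qd: "((\<lambda>t. Q (?y + t *\<^sub>R axis j 1)) has_real_derivative 0) (at 0)"
      unfolding Q_def by (auto intro!: derivative_eq_intros Fd simp: jm)
    have wd: "((\<lambda>t. w (?y + t *\<^sub>R axis j 1) $ i) has_real_derivative axis j 1 $ i) (at 0)"
      unfolding w_nth by (auto intro!: derivative_eq_intros Fd)
    have rd: "((\<lambda>t. r x \<bullet> (?y + t *\<^sub>R axis j 1)) has_real_derivative r x $ j) (at 0)"
      by (simp add: inner_add_right inner_axis) (auto intro!: derivative_eq_intros)
    have yd: "((\<lambda>t. (?y + t *\<^sub>R axis j 1) $ i) has_real_derivative axis j 1 $ i) (at 0)"
      by (auto intro!: derivative_eq_intros)
    have ry: "r x \<bullet> ?y = 0" by (simp add: inner_axis)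
    let ?G = "\<lambda>v. ((r x \<bullet> v) * v $ i - F v * Q v * r x $ i + Q v / F v * (r x \<bullet> v) * w v $ i) / 2"
    have F0: "F ?y \<noteq> 0" using F_pos[OF y] by simp
    have d: "((\<lambda>t. ?G (?y + t *\<^sub>R axis j 1)) has_real_derivative
       (r x $ j * ?y $ i + Q ?y / F ?y * r x $ j * w ?y $ i) / 2) (at 0)"
      by (rule derivative_eq_intros refl Fd Qd wd rd yd | simp add: F0 inner_axis)+
    have eq: "(r x $ j * ?y $ i + Q ?y / F ?y * r x $ j * w ?y $ i) / 2 = c * r x $ j * e i"
      unfolding axis_values[OF c] using b c by simp
    have "partial j ?G ?y = c * r x $ j * e i" by (rule partial_eqI[OF d[unfolded eq]])
    moreover have "partial j (\<lambda>v. geodesic_coeff Ft x v $ i) ?y = partial j ?G ?y"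
      by (rule partial_cong_ev) (use nonzero_near[OF y, of j] in \<open>auto elim!: eventually_mono simp: geodesic_coeff_Ft\<close>)
    ultimately show ?thesis by (simp add: nonlinear_connection_def)
  qed
  have "(\<Sum>j\<in>UNIV. nonlinear_connection Ft x ?y $ i $ j * X $ j) = (\<Sum>j\<in>UNIV. c * e i * (r x $ j * X $ j))" for i
  proof (rule sum.cong[OF refl])
    fix j
    show "nonlinear_connection Ft x ?y $ i $ j * X $ j = c * e i * (r x $ j * X $ j)"
      by (cases "j = m") (simp_all add: N X)
  qed
  then show ?thesis
    by (simp add: matrix_vector_mult_def vec_eq_iff inner_vec_def sum_distrib_left[symmetric])
qed

text \<open>Where r vanishes the spray is zero for all nonzero directions. The volume term
  differentiates the density only along \<open>axis m 1\<close>, and \<rho> is constant along it, so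
  the volume of the indicatrix never has to be evaluated.\<close>

lemma S_curvature_critical:
  assumes c: "0 < c" and r: "r x = 0"
  shows "S_curvature Ft (busemann_hausdorff Ft) x (c *\<^sub>R axis m 1) = 0"
proof -
  let ?y = "c *\<^sub>R axis m (1::real) :: real^'n"
  have y: "?y \<noteq> 0" using c by simp
  have "partial i (\<lambda>v. geodesic_coeff Ft x v $ i) ?y = partial i (\<lambda>v. 0) ?y" for i
    by (rule partial_cong_ev) (use nonzero_near[OF y, of i] in \<open>auto elim!: eventually_mono simp: geodesic_coeff_Ft r\<close>)
  then have 1: "partial i (\<lambda>v. geodesic_coeff Ft x v $ i) ?y = 0" for i
    using partial_eqI[of "\<lambda>_. 0" ?y i 0] by simp
  have "\<rho> (x + t *\<^sub>R axis m 1) = \<rho> x" for t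
    by (simp add: \<rho>_eq axis_def)
  then have "busemann_hausdorff Ft (x + t *\<^sub>R axis m 1) = busemann_hausdorff Ft x" for t
    by (simp add: busemann_hausdorff_def Ft_eq)
  then have 2: "partial m (\<lambda>z. ln (busemann_hausdorff Ft z)) x = 0"
    by (intro partial_eqI) simp
  have "?y $ i * partial i (\<lambda>z. ln (busemann_hausdorff Ft z)) x = 0" for i
    using 2 by (cases "i = m") (auto simp: axis_def)
  then show ?thesis by (simp only: S_curvature_def 1 sum.neutral_const)
qed

end

section \<open>Normal geodesics near a critical point\<close>

lemma mvt_vector_derivative:
  fixes g :: "real \<Rightarrow> real"
  assumes g: "\<And>x. x \<in> {0..T} \<Longrightarrow> (g has_vector_derivative g' x) (at x within {0..T})"
    and t: "t \<in> {0..T}"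
  shows "\<exists>x\<in>{0..t}. g t - g 0 = t * g' x"
proof -
  have "(g has_derivative (\<lambda>h. h * g' x)) (at x within {0..t})" if "x \<in> {0..t}" for x
    using g[of x] that t by (auto simp: has_vector_derivative_def intro: has_derivative_subset)
  then have "\<exists>x\<in>{0..t}. g t - g 0 = (\<lambda>h. h * g' x) (t - 0)"
    using t by (intro mvt_very_simple) auto
  then show ?thesis by simp
qed

lemma lipschitz_real_derivative:
  fixes g :: "real \<Rightarrow> real"
  assumes "\<And>x. (g has_real_derivative g' x) (at x)" "\<And>x. \<bar>g' x\<bar> \<le> B"
  shows "\<bar>g x - g y\<bar> \<le> B * \<bar>x - y\<bar>"
  using field_differentiable_bound[of UNIV g g' B x y] assms by (simp add: real_norm_def)

text \<open>With N the root, the derivative is k^2/N^3, at most 1/N, hence at most 1/k and so at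
  most 2.\<close>

lemma lipschitz_normalized:
  fixes k :: real
  assumes k: "1/2 \<le> k"
  shows "\<bar>x / sqrt (k\<^sup>2 + x\<^sup>2) - y / sqrt (k\<^sup>2 + y\<^sup>2)\<bar> \<le> 2 * \<bar>x - y\<bar>"
proof (rule lipschitz_real_derivative)
  fix x :: real
  define N where "N = sqrt (k\<^sup>2 + x\<^sup>2)"
  have S: "0 < k\<^sup>2 + x\<^sup>2" using k by (simp add: add_pos_nonneg)
  have N: "N\<^sup>2 = k\<^sup>2 + x\<^sup>2" "0 < N" using S by (simp_all add: N_def)
  have kN: "k \<le> N" unfolding N_def by (rule real_le_rsqrt) simp
  have "((\<lambda>x. x / sqrt (k\<^sup>2 + x\<^sup>2)) has_real_derivative (1 * N - x * (2 * x * (inverse N / 2))) / (N * N)) (at x)"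
  proof -
    have "((\<lambda>x. k\<^sup>2 + x\<^sup>2) has_real_derivative 2 * x) (at x)"
      by (auto intro!: derivative_eq_intros)
    from DERIV_chain2[OF DERIV_real_sqrt[OF S] this]
    have dN: "((\<lambda>x. sqrt (k\<^sup>2 + x\<^sup>2)) has_real_derivative 2 * x * (inverse N / 2)) (at x)"
      by (simp only: N_def mult.commute)
    show ?thesis
      using DERIV_divide[OF DERIV_ident dN] N(2) k by (cases "k = 0") (simp_all add: N_def)
  qed
  moreover have "(1 * N - x * (2 * x * (inverse N / 2))) / (N * N) = k\<^sup>2 / (N * N * N)"
  proof -
    have "(1 * N - x * (2 * x * (inverse N / 2))) = (N * N - x * x) / N" using N by (simp add: field_simps)
    also have "N * N - x * x = k\<^sup>2" using N by (simp add: power2_eq_square)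
    finally show ?thesis by simp
  qed
  ultimately show "((\<lambda>x. x / sqrt (k\<^sup>2 + x\<^sup>2)) has_real_derivative k\<^sup>2 / (sqrt (k\<^sup>2 + x\<^sup>2) * sqrt (k\<^sup>2 + x\<^sup>2) * sqrt (k\<^sup>2 + x\<^sup>2))) (at x)"
    by (simp add: N_def)
  have "k\<^sup>2 / (N * N * N) \<le> (N * N) / (N * N * N)"
    using N by (intro divide_right_mono) (auto simp: power2_eq_square)
  also have "\<dots> = 1 / N" using N by simp
  also have "\<dots> \<le> 2" using kN k N by (simp add: field_simps)
  finally show "\<bar>k\<^sup>2 / (sqrt (k\<^sup>2 + x\<^sup>2) * sqrt (k\<^sup>2 + x\<^sup>2) * sqrt (k\<^sup>2 + x\<^sup>2))\<bar> \<le> 2"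
    using N unfolding N_def[symmetric] by simp
qed

text \<open>The Lipschitz constant 70 is 4 (exponential factor) + 64 (f) + 2 (normalized momentum),
  where \<open>0 \<le> R u\<close> bounds the exponential by 1. Over time 1/100 the Picard factor is
  0.7.\<close>

lemma plane_flow_exists:
  fixes R f :: "real \<Rightarrow> real"
  assumes R: "\<And>u. (R has_real_derivative f u) (at u)" and R0: "\<And>u. 0 \<le> R u"
    and f4: "\<And>u. \<bar>f u\<bar> \<le> 4" and lf: "\<And>u v. \<bar>f u - f v\<bar> \<le> 64 * \<bar>u - v\<bar>"
    and k: "1/2 \<le> k"
  shows "\<exists>w \<xi>. w 0 = s \<and> \<xi> 0 = 0 \<and> (\<forall>\<tau>\<in>{0..1/100}.
      (w has_vector_derivative exp (- R (w \<tau>)) * (\<xi> \<tau> / sqrt (k\<^sup>2 + (\<xi> \<tau>)\<^sup>2))) (at \<tau> within {0..1/100}) \<and>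
      (\<xi> has_vector_derivative f (w \<tau>)) (at \<tau> within {0..1/100}))"
proof -
  define \<psi> where "\<psi> x = x / sqrt (k\<^sup>2 + x\<^sup>2)" for x
  define V where "V = (\<lambda>(u, x). (exp (- R u) * \<psi> x, f u))"
  have \<psi>1: "\<bar>\<psi> x\<bar> \<le> 1" for x
  proof -
    have "\<bar>x\<bar> \<le> sqrt (k\<^sup>2 + x\<^sup>2)" by (rule real_le_rsqrt) simp
    moreover have "0 < sqrt (k\<^sup>2 + x\<^sup>2)" using k by (simp add: add_pos_nonneg)
    ultimately show ?thesis by (simp add: \<psi>_def abs_divide)
  qed
  have le: "\<bar>exp (- R u) - exp (- R v)\<bar> \<le> 4 * \<bar>u - v\<bar>" for u v
  proof (rule lipschitz_real_derivative)
    show "((\<lambda>u. exp (- R u)) has_real_derivative exp (- R u) * (- f u)) (at u)" for u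
      by (auto intro!: derivative_eq_intros R)
    show "\<bar>exp (- R u) * - f u\<bar> \<le> 4" for u
      using mult_mono[of "exp (- R u)" 1 "\<bar>f u\<bar>" 4] R0[of u] f4[of u] by (simp add: abs_mult)
  qed
  have lip: "norm (V p - V p') \<le> 70 * norm (p - p')" for p p'
  proof -
    obtain u x v y where p: "p = (u, x)" "p' = (v, y)" by fastforce
    have "exp (- R u) * \<psi> x - exp (- R v) * \<psi> y
        = (exp (- R u) - exp (- R v)) * \<psi> x + exp (- R v) * (\<psi> x - \<psi> y)"
      by (simp add: algebra_simps)
    also have "\<bar>\<dots>\<bar> \<le> \<bar>exp (- R u) - exp (- R v)\<bar> * \<bar>\<psi> x\<bar> + exp (- R v) * \<bar>\<psi> x - \<psi> y\<bar>"
      by (rule order_trans[OF abs_triangle_ineq]) (simp add: abs_mult)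
    also have "\<dots> \<le> (4 * \<bar>u - v\<bar>) * 1 + 1 * (2 * \<bar>x - y\<bar>)"
      using R0[of v] by (intro add_mono mult_mono le \<psi>1 lipschitz_normalized[OF k, folded \<psi>_def]) auto
    finally have 1: "\<bar>exp (- R u) * \<psi> x - exp (- R v) * \<psi> y\<bar> \<le> 4 * \<bar>u - v\<bar> + 2 * \<bar>x - y\<bar>" by simp
    have "norm (V p - V p') \<le> \<bar>exp (- R u) * \<psi> x - exp (- R v) * \<psi> y\<bar> + \<bar>f u - f v\<bar>"
      unfolding p V_def using norm_Pair_le[of "exp (- R u) * \<psi> x - exp (- R v) * \<psi> y" "f u - f v"] by simp
    also have "\<dots> \<le> 68 * \<bar>u - v\<bar> + 2 * \<bar>x - y\<bar>" using 1 lf[of u v] by simp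
    also have "\<bar>u - v\<bar> \<le> norm (p - p')" unfolding p using norm_fst_le[of "u - v" "x - y"] by simp
    also have "\<bar>x - y\<bar> \<le> norm (p - p')" unfolding p using norm_snd_le[of "x - y" "u - v"] by simp
    finally show ?thesis by simp
  qed
  obtain p where p0: "p 0 = (s, 0)"
    and p: "\<And>t. t \<in> {0..1/100} \<Longrightarrow> (p has_vector_derivative V (p t)) (at t within {0..1/100})"
    using picard_global[of V 70 "1/100" "(s, 0)"] lip by auto
  show ?thesis
  proof (intro exI conjI ballI)
    show "fst (p 0) = s" "snd (p 0) = 0" by (simp_all add: p0)
    fix t :: real assume t: "t \<in> {0..1/100}"
    have V: "fst (V q) = exp (- R (fst q)) * \<psi> (snd q)" "snd (V q) = f (fst q)" for q
      by (simp_all add: V_def split: prod.split)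
    show "((\<lambda>t. fst (p t)) has_vector_derivative
        exp (- R (fst (p t))) * (snd (p t) / sqrt (k\<^sup>2 + (snd (p t))\<^sup>2))) (at t within {0..1/100})"
      using bounded_linear.has_vector_derivative[OF bounded_linear_fst p[OF t]] V
      by (simp add: \<psi>_def)
    show "((\<lambda>t. snd (p t)) has_vector_derivative f (fst (p t))) (at t within {0..1/100})"
      using bounded_linear.has_vector_derivative[OF bounded_linear_snd p[OF t]] V
      by simp
  qed
qed

text \<open>Self-bounding argument. If \<mu> is the maximum of the absolute value of w, then \<xi>
  is at most 0.64 \<mu>, so w moves away from s by at most \<mu>/4; hence \<mu> is at most 4/3 s and
  w stays above s - \<mu>/4, which is at least 2/3 s. As s is at most 1/8, w remains in the interval
  where the sign condition on f applies.\<close>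

lemma plane_flow_bounds:
  fixes R f w \<xi> :: "real \<Rightarrow> real"
  assumes R: "\<And>u. (R has_real_derivative f u) (at u)" and R0: "\<And>u. 0 \<le> R u"
    and lf: "\<And>u v. \<bar>f u - f v\<bar> \<le> 64 * \<bar>u - v\<bar>" and f0: "f 0 = 0"
    and \<sigma>: "\<forall>u\<in>{0..1/4}. u \<le> \<sigma> * f u"
    and k: "1/2 \<le> k" and s: "0 \<le> s" "s \<le> 1/8"
    and w0: "w 0 = s" and \<xi>0: "\<xi> 0 = 0"
    and flow: "\<forall>\<tau>\<in>{0..1/100}. (w has_vector_derivative
      exp (- R (w \<tau>)) * (\<xi> \<tau> / sqrt (k\<^sup>2 + (\<xi> \<tau>)\<^sup>2))) (at \<tau> within {0..1/100})"
      "\<forall>\<tau>\<in>{0..1/100}. (\<xi> has_vector_derivative f (w \<tau>)) (at \<tau> within {0..1/100})"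
    and t: "t \<in> {0..1/100}"
  shows "2/3 * s \<le> w t" "w t \<le> 4/3 * s" "\<bar>\<xi> t\<bar> \<le> s" "2/3 * s * t \<le> \<sigma> * \<xi> t"
    and "\<bar>exp (- R (w t)) - exp (- R 0)\<bar> \<le> 114 * s\<^sup>2"
proof -
  let ?I = "{0..1/100::real}"
  note w = bspec[OF flow(1)] and \<xi> = bspec[OF flow(2)]
  have fb: "\<bar>f u\<bar> \<le> 64 * \<bar>u\<bar>" for u using lf[of u 0] f0 by simp
  have cw: "continuous_on ?I w"
    unfolding continuous_on_eq_continuous_within using has_vector_derivative_continuous[OF w] by blast
  have "\<exists>x\<in>?I. \<forall>y\<in>?I. \<bar>w y\<bar> \<le> \<bar>w x\<bar>"
    by (rule continuous_attains_sup) (auto intro!: continuous_intros cw)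
  then obtain t0 where t0: "t0 \<in> ?I" "\<And>y. y \<in> ?I \<Longrightarrow> \<bar>w y\<bar> \<le> \<bar>w t0\<bar>" by blast
  define \<mu> where "\<mu> = \<bar>w t0\<bar>"
  have x\<mu>: "\<bar>\<xi> t\<bar> \<le> 64 / 100 * \<mu>" if t: "t \<in> ?I" for t
  proof -
    obtain x where x: "x \<in> {0..t}" "\<xi> t - \<xi> 0 = t * f (w x)"
      using mvt_vector_derivative[OF \<xi> t] by blast
    have "\<bar>f (w x)\<bar> \<le> 64 * \<mu>" using fb[of "w x"] t0(2)[of x] x(1) t by (auto simp: \<mu>_def)
    then have "\<bar>\<xi> t\<bar> \<le> 1/100 * (64 * \<mu>)"
      using x(2) \<xi>0 t mult_mono[of t "1/100" "\<bar>f (w x)\<bar>" "64 * \<mu>"] by (simp add: abs_mult)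
    then show ?thesis by simp
  qed
  have w\<mu>: "\<bar>w t - s\<bar> \<le> \<mu> / 4" if t: "t \<in> ?I" for t
  proof -
    obtain x where x: "x \<in> {0..t}" "w t - w 0 = t * (exp (- R (w x)) * (\<xi> x / sqrt (k\<^sup>2 + (\<xi> x)\<^sup>2)))"
      using mvt_vector_derivative[OF w t] by blast
    have kN: "k \<le> sqrt (k\<^sup>2 + (\<xi> x)\<^sup>2)" by (rule real_le_rsqrt) simp
    then have N: "1/2 \<le> sqrt (k\<^sup>2 + (\<xi> x)\<^sup>2)" using k by linarith
    have "\<bar>\<xi> x\<bar> / sqrt (k\<^sup>2 + (\<xi> x)\<^sup>2) \<le> \<bar>\<xi> x\<bar> / (1/2)"
      by (rule divide_left_mono[OF N abs_ge_zero]) (use N in linarith)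
    then have "\<bar>\<xi> x / sqrt (k\<^sup>2 + (\<xi> x)\<^sup>2)\<bar> \<le> \<bar>\<xi> x\<bar> / (1/2)"
      by (simp add: abs_divide)
    also have "\<dots> \<le> 2 * (64 / 100 * \<mu>)" using x\<mu>[of x] x(1) t by auto
    finally have 1: "\<bar>\<xi> x / sqrt (k\<^sup>2 + (\<xi> x)\<^sup>2)\<bar> \<le> 128 / 100 * \<mu>" by simp
    have "\<bar>w t - s\<bar> = t * (exp (- R (w x)) * \<bar>\<xi> x / sqrt (k\<^sup>2 + (\<xi> x)\<^sup>2)\<bar>)"
      using x(2) w0 t by (simp add: abs_mult abs_divide)
    also have "\<dots> \<le> 1/100 * (1 * (128 / 100 * \<mu>))"
      using t R0[of "w x"] by (intro mult_mono 1) (auto simp: \<mu>_def)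
    finally show ?thesis by (simp add: \<mu>_def)
  qed
  have \<mu>: "\<mu> \<le> 4/3 * s" "0 \<le> \<mu>" using w\<mu>[OF t0(1)] s by (auto simp: \<mu>_def abs_if split: if_splits)
  have wb: "2/3 * s \<le> w t \<and> w t \<le> 4/3 * s" if "t \<in> ?I" for t
    using abs_ge_self[of "w t - s"] abs_ge_minus_self[of "w t - s"] w\<mu>[OF that] \<mu> by simp
  then show lo: "2/3 * s \<le> w t" and hi: "w t \<le> 4/3 * s" using t by auto
  show "\<bar>\<xi> t\<bar> \<le> s" using x\<mu>[OF t] \<mu> s by simp
  obtain x where x: "x \<in> {0..t}" "\<xi> t - \<xi> 0 = t * f (w x)"
    using mvt_vector_derivative[OF \<xi> t] by blast
  have "2/3 * s \<le> \<sigma> * f (w x)"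
    using wb[of x] x(1) t s bspec[OF \<sigma>, of "w x"] by auto
  then show "2/3 * s * t \<le> \<sigma> * \<xi> t"
    using x(2) \<xi>0 t mult_left_mono[of "2/3 * s" "\<sigma> * f (w x)" t] by (simp add: algebra_simps)
  show "\<bar>exp (- R (w t)) - exp (- R 0)\<bar> \<le> 114 * s\<^sup>2"
  proof (cases "w t = 0")
    case False
    then have wt: "0 < w t" using lo s by auto
    have "\<exists>z>0. z < w t \<and> exp (- R (w t)) - exp (- R 0) = (w t - 0) * (exp (- R z) * (- f z))"
      by (rule MVT2[OF wt]) (auto intro!: derivative_eq_intros R)
    then obtain z where z: "0 < z" "z < w t"
      and eq: "exp (- R (w t)) - exp (- R 0) = w t * (exp (- R z) * (- f z))" by auto
    have "\<bar>exp (- R (w t)) - exp (- R 0)\<bar> = w t * (exp (- R z) * \<bar>f z\<bar>)"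
      using wt by (simp add: eq abs_mult)
    \<comment> \<open>Since f vanishes at 0, the mean value estimate is quadratic in s: 64 times
      16/9 is just below 114.\<close>
    also have "\<dots> \<le> (4/3 * s) * (1 * (64 * (4/3 * s)))"
      using z wt hi fb[of z] R0[of z] by (intro mult_mono) auto
    also have "\<dots> \<le> 114 * s\<^sup>2" by (simp add: power2_eq_square)
    finally show ?thesis .
  qed simp
qed

text \<open>R is \<rho> along a coordinate line through a critical point, shifted to u = 0:
  \<open>c0\<close> collects the other coordinates, and \<sigma> is 1 at a maximum and -1 at a
  minimum. f is the derivative of R.\<close>

lemma axis_profile:
  fixes \<sigma> c0 :: real
  assumes \<sigma>: "\<bar>\<sigma>\<bar> = 1" and c0: "0 \<le> c0"
  defines "R \<equiv> \<lambda>u. c0 + ln (2 + \<sigma> * cos (pi * u))"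
    and "f \<equiv> \<lambda>u. - \<sigma> * pi * sin (pi * u) / (2 + \<sigma> * cos (pi * u))"
  shows "\<And>u. (R has_real_derivative f u) (at u)" and "\<And>u. 0 \<le> R u"
    and "\<And>u. \<bar>f u\<bar> \<le> 4" and "\<And>u v. \<bar>f u - f v\<bar> \<le> 64 * \<bar>u - v\<bar>" and "f 0 = 0"
    and "\<forall>u\<in>{0..1/4}. u \<le> - \<sigma> * f u"
proof -
  have \<sigma>2: "\<sigma> * \<sigma> = 1" using \<sigma> by (auto simp: abs_if split: if_splits)
  have ge1: "1 \<le> 2 + \<sigma> * cos x" "2 + \<sigma> * cos x \<le> 3" for x :: real
  proof -
    have "\<bar>\<sigma> * cos x\<bar> \<le> 1" using \<sigma> by (simp add: abs_mult)
    then show "1 \<le> 2 + \<sigma> * cos x" "2 + \<sigma> * cos x \<le> 3" by linarith+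
  qed
  have ne: "2 + \<sigma> * cos x \<noteq> 0" "0 < 2 + \<sigma> * cos x" for x :: real using ge1[of x] by linarith+
  show "(R has_real_derivative f u) (at u)" for u
    unfolding R_def f_def using ne[of "pi * u"] by (auto intro!: derivative_eq_intros simp: field_simps)
  show "0 \<le> R u" for u
    unfolding R_def using c0 ge1(1)[of "pi * u"] by simp
  show "\<bar>f u\<bar> \<le> 4" for u
  proof -
    have "\<bar>f u\<bar> = pi * \<bar>sin (pi * u)\<bar> / (2 + \<sigma> * cos (pi * u))"
      unfolding f_def using \<sigma> ne(2)[of "pi * u"] by (simp add: abs_mult abs_divide)
    also have "\<dots> \<le> (4 * 1) / 1"
      using pi_less_4 pi_ge_two ge1(1)[of "pi * u"] abs_sin_le_one[of "pi * u"]
      by (intro frac_le mult_mono) auto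
    finally show ?thesis by simp
  qed
  show "\<bar>f u - f v\<bar> \<le> 64 * \<bar>u - v\<bar>" for u v
  proof (rule lipschitz_real_derivative)
    fix u
    let ?c = "cos (pi * u)" and ?s = "sin (pi * u)"
    have n: "((\<lambda>u. - \<sigma> * pi * sin (pi * u)) has_real_derivative - \<sigma> * pi * (?c * pi)) (at u)"
      "((\<lambda>u. 2 + \<sigma> * cos (pi * u)) has_real_derivative \<sigma> * (- ?s * pi)) (at u)"
      by (auto intro!: derivative_eq_intros)
    have "(f has_real_derivative
      (- \<sigma> * pi * (?c * pi) * (2 + \<sigma> * ?c) - (- \<sigma> * pi * ?s) * (\<sigma> * (- ?s * pi))) / ((2 + \<sigma> * ?c) * (2 + \<sigma> * ?c))) (at u)"
      unfolding f_def by (rule DERIV_divide[OF n ne(1)])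
    moreover have "- \<sigma> * pi * (?c * pi) * (2 + \<sigma> * ?c) - (- \<sigma> * pi * ?s) * (\<sigma> * (- ?s * pi)) = - (pi * pi) * (2 * \<sigma> * ?c + (\<sigma> * \<sigma>) * (?c * ?c + ?s * ?s))"
      by algebra
    ultimately show "(f has_real_derivative - (pi * pi) * (2 * \<sigma> * ?c + 1) / ((2 + \<sigma> * ?c) * (2 + \<sigma> * ?c))) (at u)"
      by (simp only: \<sigma>2 sin_cos_squared_add3 mult_1)
    have "\<bar>- (pi * pi) * (2 * \<sigma> * ?c + 1) / ((2 + \<sigma> * ?c) * (2 + \<sigma> * ?c))\<bar>
      = (pi * pi) * \<bar>2 * (\<sigma> * ?c) + 1\<bar> / ((2 + \<sigma> * ?c) * (2 + \<sigma> * ?c))"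
      by (simp add: abs_mult abs_divide mult.assoc)
    \<comment> \<open>Bounds used: pi is below 4, the middle factor is at most 4 in absolute value,
      and the denominators are at least 1.\<close>
    also have "\<dots> \<le> (4 * 4) * 4 / (1 * 1)"
      using pi_less_4 pi_ge_two ge1[of "pi * u"] by (intro frac_le mult_mono) (auto simp: abs_le_iff)
    finally show "\<bar>- (pi * pi) * (2 * \<sigma> * ?c + 1) / ((2 + \<sigma> * ?c) * (2 + \<sigma> * ?c))\<bar> \<le> 64" by simp
  qed
  show "f 0 = 0" by (simp add: f_def)
  show "\<forall>u\<in>{0..1/4}. u \<le> - \<sigma> * f u"
  proof
    fix u :: real assume "u \<in> {0..1/4}"
    then have u: "0 \<le> u" "u \<le> 1/4" by auto
    \<comment> \<open>The denominator of f is at most 3, so it suffices that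
      \<open>pi * sin (pi * u)\<close> dominates 3 u. Its derivative is at least 9/2, because pi v
      lies below pi/3 where the cosine is at least 1/2.\<close>
    define g where "g u = pi * sin (pi * u) - 3 * u" for u
    have "g 0 \<le> g u"
    proof (rule DERIV_nonneg_imp_nondecreasing[OF u(1)])
      fix v assume v: "0 \<le> v" "v \<le> u"
      have "cos (pi / 3) \<le> cos (pi * v)"
        using v u pi_ge_zero by (intro cos_monotone_0_pi_le) (auto simp: field_simps)
      then have "1/2 \<le> cos (pi * v)" by (simp add: cos_60)
      then have "3 * 3 * (1/2) \<le> pi * pi * cos (pi * v)"
        using pi_gt3 by (intro mult_mono) auto
      then have "0 \<le> pi * (cos (pi * v) * pi) - 3" by (simp add: mult_ac)
      moreover have "(g has_real_derivative pi * (cos (pi * v) * pi) - 3) (at v)"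
        unfolding g_def by (auto intro!: derivative_eq_intros)
      ultimately show "\<exists>y. (g has_real_derivative y) (at v) \<and> 0 \<le> y" by blast
    qed
    then have g: "3 * u \<le> pi * sin (pi * u)" by (simp add: g_def)
    have "- \<sigma> * f u = pi * sin (pi * u) / (2 + \<sigma> * cos (pi * u))"
      unfolding f_def using \<sigma>2 by (simp add: mult.assoc[symmetric])
    moreover have "3 * u / 3 \<le> pi * sin (pi * u) / (2 + \<sigma> * cos (pi * u))"
      using g u ge1[of "pi * u"] ne(2)[of "pi * u"] by (intro frac_le) auto
    ultimately show "u \<le> - \<sigma> * f u" by simp
  qed
qed

section \<open>Geodesics in coordinate planes through a critical point\<close>

context randers_conformal
begin

text \<open>\<sigma> = 1 gives maxima of \<rho> and \<sigma> = -1 minima. Requiring the same type in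
  all coordinates makes all principal curvatures over p have the same sign.\<close>

definition critical_point :: "real \<Rightarrow> real^'n \<Rightarrow> bool" where
  "critical_point \<sigma> p \<longleftrightarrow> \<bar>\<sigma>\<bar> = 1 \<and> p $ m = x0 \<and>
     (\<forall>i. i \<noteq> m \<longrightarrow> cos (pi * p $ i) = \<sigma> \<and> sin (pi * p $ i) = 0)"

text \<open>As \<open>sin (pi * p $ a)\<close> is 0, the addition theorem gives \<sigma> times the
  shifted cosine. The gradient stays parallel to the plane at all its points, which keeps the
  geodesics in it. The last claim makes the constant \<open>c0\<close> of
  \<open>axis_profile\<close> nonnegative.\<close>

lemma critical_plane:
  assumes p: "critical_point \<sigma> p" and a: "a \<noteq> m"
  shows "\<rho> (p + u *\<^sub>R axis a 1 + z *\<^sub>R axis m 1) = \<rho> p - ln (2 + \<sigma>) + ln (2 + \<sigma> * cos (pi * u))"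
    and "r (p + u *\<^sub>R axis a 1 + z *\<^sub>R axis m 1)
      = (- \<sigma> * pi * sin (pi * u) / (2 + \<sigma> * cos (pi * u))) *\<^sub>R axis a 1"
    and "0 \<le> \<rho> p - ln (2 + \<sigma>)"
proof -
  let ?x = "p + u *\<^sub>R axis a 1 + z *\<^sub>R axis m (1::real)"
  have xa: "?x $ a = p $ a + u" using a by (simp add: axis_def)
  have xi: "?x $ i = p $ i" if "i \<noteq> a" "i \<noteq> m" for i using that by (simp add: axis_def)
  have ca: "cos (pi * ?x $ a) = \<sigma> * cos (pi * u)" "sin (pi * ?x $ a) = \<sigma> * sin (pi * u)"
    using p a unfolding xa critical_point_def by (simp_all add: distrib_left cos_add sin_add)
  have ci: "cos (pi * p $ i) = \<sigma>" "sin (pi * p $ i) = 0" if "i \<noteq> m" for i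
    using p that by (simp_all add: critical_point_def)
  have fin: "finite (UNIV - {m})" "a \<in> UNIV - {m}" using a by auto
  have \<rho>p: "\<rho> p = ln (2 + \<sigma>) + (\<Sum>i\<in>UNIV - {m} - {a}. ln (2 + \<sigma>))"
    unfolding \<rho>_eq by (subst sum.remove[OF fin]) (simp add: ci a)
  have "\<rho> ?x = ln (2 + \<sigma> * cos (pi * u)) + (\<Sum>i\<in>UNIV - {m} - {a}. ln (2 + cos (pi * ?x $ i)))"
    unfolding \<rho>_eq by (subst sum.remove[OF fin]) (simp only: ca)
  also have "(\<Sum>i\<in>UNIV - {m} - {a}. ln (2 + cos (pi * ?x $ i))) = (\<Sum>i\<in>UNIV - {m} - {a}. ln (2 + \<sigma>))"
    by (rule sum.cong[OF refl]) (simp only: xi ci Diff_iff singleton_iff not_False_eq_True)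
  finally show "\<rho> ?x = \<rho> p - ln (2 + \<sigma>) + ln (2 + \<sigma> * cos (pi * u))" by (simp add: \<rho>p)
  have "0 \<le> ln (2 + \<sigma>)" using p by (auto simp: critical_point_def abs_if split: if_splits)
  then show "0 \<le> \<rho> p - ln (2 + \<sigma>)" unfolding \<rho>p by (simp add: sum_nonneg)
  show "r ?x = (- \<sigma> * pi * sin (pi * u) / (2 + \<sigma> * cos (pi * u))) *\<^sub>R axis a 1"
    unfolding vec_eq_iff
  proof
    fix i
    show "r ?x $ i = ((- \<sigma> * pi * sin (pi * u) / (2 + \<sigma> * cos (pi * u))) *\<^sub>R axis a 1) $ i"
    proof (cases "i = a")
      case True
      then show ?thesis using a by (simp only: r_def vec_lambda_beta ca if_False) (simp add: algebra_simps)
    next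
      case False
      show ?thesis
      proof (cases "i = m")
        case True
        then show ?thesis using a by (simp add: axis_def)
      next
        case im: False
        show ?thesis
          unfolding r_def vec_lambda_beta xi[OF False im] ci[OF im] using False by (simp add: axis_def)
      qed
    qed
  qed
qed

lemma critical_point_r: "critical_point \<sigma> p \<Longrightarrow> r (p + z *\<^sub>R axis m 1) = 0"
  by (auto simp: r_def critical_point_def vec_eq_iff axis_def)

text \<open>Provides a lower bound for \<open>exp (- 2 * \<rho> x)\<close> independent of the point,
  so that the velocity estimate survives the limit of starting points.\<close>

lemma \<rho>_le: "\<rho> x \<le> CARD('n) * ln 3"
proof -
  have "\<rho> x \<le> (\<Sum>a\<in>UNIV - {m}. ln 3)"
    unfolding \<rho>_eq
  proof (rule sum_mono)
    fix a
    show "ln (2 + cos (pi * x $ a)) \<le> ln 3"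
      using two_cos_pos[of "pi * x $ a"] cos_le_one[of "pi * x $ a"] by simp
  qed
  also have "\<dots> \<le> (\<Sum>a\<in>(UNIV::'n set). ln 3)" by (rule sum_mono2) auto
  finally show ?thesis by simp
qed

text \<open>With \<open>(\<xi>, k)\<close> the components along \<open>axis a 1\<close> and \<open>axis m 1\<close> of the momentum, the
  fibre derivative of \<open>Ft\<^sup>2 / 2\<close>, the flow in this plane reads \<open>u' = exp (- R u) \<xi> / N\<close>, \<open>\<xi>' = R' u\<close>, where
  \<open>N = sqrt (k\<^sup>2 + \<xi>\<^sup>2)\<close>. Translations along \<open>axis m 1\<close> are isometries, so \<open>k\<close> is constant, and unit
  speed is the conservation law \<open>N + b k = exp (R u)\<close>.\<close>

lemma geodesic_family:
  assumes p: "critical_point \<sigma> p" and a: "a \<noteq> m" and s: "0 \<le> s" "s \<le> 1/8"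
    and t: "0 < t" "t \<le> 1/100"
  shows "\<exists>u v \<zeta> \<eta>. normal_geodesic_reaches Ft M nt t
      (p + u *\<^sub>R axis a 1 + (t * ((1 + b) * exp (- \<rho> p)) + \<zeta>) *\<^sub>R axis m 1)
      (v *\<^sub>R axis a 1 + ((1 + b) * exp (- \<rho> p) + \<eta>) *\<^sub>R axis m 1) \<and>
    2/3 * s \<le> u \<and> u \<le> 4/3 * s \<and> \<bar>v\<bar> \<le> 2 * s \<and> \<bar>\<zeta>\<bar> \<le> 230 * s\<^sup>2 \<and> \<bar>\<eta>\<bar> \<le> 230 * s\<^sup>2 \<and>
    exp (- 2 * (CARD('n) * ln 3)) * (2/3 * s * t) \<le> - \<sigma> * v"
proof -
  define c0 where "c0 = \<rho> p - ln (2 + \<sigma>)"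
  define R where "R u = c0 + ln (2 + \<sigma> * cos (pi * u))" for u
  define f where "f u = - \<sigma> * pi * sin (pi * u) / (2 + \<sigma> * cos (pi * u))" for u
  have \<sigma>: "\<bar>\<sigma>\<bar> = 1" and c0: "0 \<le> c0"
    using p critical_plane(3)[OF p a] by (simp_all add: c0_def critical_point_def)
  note prof = axis_profile[OF \<sigma> c0, folded R_def f_def]
  have \<rho>R: "\<rho> (p + u *\<^sub>R axis a 1 + z *\<^sub>R axis m 1) = R u" for u z
    using critical_plane(1)[OF p a] by (simp add: R_def c0_def)
  have rf: "r (p + u *\<^sub>R axis a 1 + z *\<^sub>R axis m 1) = f u *\<^sub>R axis a 1" for u z
    using critical_plane(2)[OF p a] by (simp add: f_def)
  have \<rho>p: "\<rho> p = R 0" using \<rho>R[of 0 0] by simp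
  have b: "0 < 1 + b" using b0 by simp
  \<comment> \<open>Chosen so that N + b k = exp (R u) holds at time 0, where \<xi> = 0 and N = k.
    Nonnegativity of R and b < 1 give the lower bound 1/2.\<close>
  define k where "k = exp (R s) / (1 + b)"
  have k: "1/2 \<le> k"
    using prof(2)[of s] b0 b1 frac_le[of "exp (R s)" 1 "1 + b" 2] by (simp add: k_def)
  define z0 where "z0 = (1 + b) * exp (- \<rho> p)"
  let ?I = "{0..1/100::real}"
  obtain u \<xi> where u0: "u 0 = s" and \<xi>0: "\<xi> 0 = 0"
    and du: "\<forall>\<tau>\<in>?I. (u has_vector_derivative exp (- R (u \<tau>)) * (\<xi> \<tau> / sqrt (k\<^sup>2 + (\<xi> \<tau>)\<^sup>2))) (at \<tau> within ?I)"
    and d\<xi>: "\<forall>\<tau>\<in>?I. (\<xi> has_vector_derivative f (u \<tau>)) (at \<tau> within ?I)"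
    using plane_flow_exists[of R f k s] prof k by metis

  \<comment> \<open>The sign parameter is - \<sigma>: for small u > 0 the force f is negative near a
    maximum and positive near a minimum.\<close>
  note bounds = plane_flow_bounds[of R f "- \<sigma>" k s u \<xi>, OF prof(1,2,4-6) k s u0 \<xi>0 du d\<xi>]
  define E where "E \<tau> = exp (- R (u \<tau>))" for \<tau>
  define N where "N \<tau> = sqrt (k\<^sup>2 + (\<xi> \<tau>)\<^sup>2)" for \<tau>
  \<comment> \<open>The velocity is E times the Euclidean unit vector (\<xi>, k)/N plus the drift b
    E along \<open>axis m 1\<close>, which is Zermelo form with F equal to E.\<close>
  define u' where "u' \<tau> = E \<tau> * (\<xi> \<tau> / N \<tau>)" for \<tau>
  define z' where "z' \<tau> = E \<tau> * (k / N \<tau> + b)" for \<tau>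
  \<comment> \<open>The right-hand side does not involve z, so this coordinate is a mere integral
    and the differential system to solve stays two-dimensional.\<close>
  define z where "z \<tau> = integral {0..\<tau>} z'" for \<tau>
  have S: "0 < k\<^sup>2 + (\<xi> \<tau>)\<^sup>2" for \<tau> using k by (simp add: add_pos_nonneg)
  have N2: "(N \<tau>)\<^sup>2 = k\<^sup>2 + (\<xi> \<tau>)\<^sup>2" and N: "0 < N \<tau>" and kN: "k \<le> N \<tau>" for \<tau>
    using S[of \<tau>] unfolding N_def by (auto intro: real_le_rsqrt)
  have E: "0 < E \<tau>" "E \<tau> \<le> 1" "exp (R (u \<tau>)) * E \<tau> = 1" for \<tau>
    using prof(2)[of "u \<tau>"] by (simp_all add: E_def mult_exp_exp)
  have du: "(u has_real_derivative u' \<tau>) (at \<tau> within ?I)"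
    and d\<xi>: "(\<xi> has_real_derivative f (u \<tau>)) (at \<tau> within ?I)" if "\<tau> \<in> ?I" for \<tau>
    using bspec[OF du that] bspec[OF d\<xi> that]
    by (simp_all add: has_real_derivative_iff_has_vector_derivative u'_def E_def N_def)
  have dR: "((\<lambda>\<tau>. R (u \<tau>)) has_real_derivative f (u \<tau>) * u' \<tau>) (at \<tau> within ?I)" if "\<tau> \<in> ?I" for \<tau>
    by (rule DERIV_chain2[OF prof(1) du[OF that]])
  have dE: "(E has_real_derivative - (f (u \<tau>) * u' \<tau>) * E \<tau>) (at \<tau> within ?I)" if "\<tau> \<in> ?I" for \<tau>
    unfolding E_def by (auto intro!: derivative_eq_intros dR that)
  have dN: "(N has_real_derivative \<xi> \<tau> * f (u \<tau>) / N \<tau>) (at \<tau> within ?I)" if "\<tau> \<in> ?I" for \<tau>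
  proof -
    have "((\<lambda>\<tau>. k\<^sup>2 + (\<xi> \<tau>)\<^sup>2) has_real_derivative 2 * \<xi> \<tau> * f (u \<tau>)) (at \<tau> within ?I)"
      by (auto intro!: derivative_eq_intros d\<xi> that)
    from DERIV_chain2[OF DERIV_real_sqrt[OF S] this]
    have "(N has_real_derivative inverse (N \<tau>) / 2 * (2 * \<xi> \<tau> * f (u \<tau>))) (at \<tau> within ?I)"
      by (simp only: N_def[abs_def])
    moreover have "inverse (N \<tau>) / 2 * (2 * \<xi> \<tau> * f (u \<tau>)) = \<xi> \<tau> * f (u \<tau>) / N \<tau>"
      using N[of \<tau>] by (simp add: field_simps)
    ultimately show ?thesis by simp
  qed
  \<comment> \<open>N and exp (R u) both have derivative \<xi> f / N, because exp (R u) times E is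
    1; the initial values agree by the choice of k.\<close>
  have energy: "N \<tau> + b * k = exp (R (u \<tau>))" if \<tau>: "\<tau> \<in> ?I" for \<tau>
  proof -
    have "((\<lambda>\<tau>. N \<tau> + b * k - exp (R (u \<tau>))) has_vector_derivative 0) (at \<tau> within ?I)" if "\<tau> \<in> ?I" for \<tau>
    proof -
      have "((\<lambda>\<tau>. N \<tau> + b * k - exp (R (u \<tau>))) has_real_derivative
          \<xi> \<tau> * f (u \<tau>) / N \<tau> + 0 - exp (R (u \<tau>)) * (f (u \<tau>) * u' \<tau>)) (at \<tau> within ?I)"
        by (intro DERIV_diff DERIV_add dN DERIV_const DERIV_chain2[OF DERIV_exp] dR that)
      moreover have "exp (R (u \<tau>)) * (f (u \<tau>) * u' \<tau>) = (exp (R (u \<tau>)) * E \<tau>) * (\<xi> \<tau> * f (u \<tau>) / N \<tau>)"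
        by (simp add: u'_def)
      ultimately show ?thesis unfolding E by (simp add: has_real_derivative_iff_has_vector_derivative)
    qed
    from mvt_vector_derivative[OF this \<tau>]
    have "N \<tau> + b * k - exp (R (u \<tau>)) = N 0 + b * k - exp (R s)" by (simp add: u0)
    also have "N 0 = k" using k by (simp add: N_def \<xi>0)
    also have "k + b * k - exp (R s) = (1 + b) * k - exp (R s)" by (simp add: algebra_simps)
    also have "\<dots> = 0" using b by (simp add: k_def)
    finally show ?thesis by simp
  qed
  have dz: "(z has_vector_derivative z' \<tau>) (at \<tau> within ?I)" if "\<tau> \<in> ?I" for \<tau>
  proof -
    have "continuous_on ?I E" "continuous_on ?I N"
      unfolding continuous_on_eq_continuous_within using DERIV_continuous[OF dE] DERIV_continuous[OF dN] by blast+
    then have "continuous_on ?I z'"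
      unfolding z'_def using N by (auto intro!: continuous_intros simp: less_imp_neq[symmetric])
    then show ?thesis unfolding z_def[abs_def] by (rule integral_has_vector_derivative) (rule that)
  qed
  define \<gamma> where "\<gamma> \<tau> = p + u \<tau> *\<^sub>R axis a 1 + z \<tau> *\<^sub>R axis m 1" for \<tau>
  define \<gamma>' where "\<gamma>' \<tau> = u' \<tau> *\<^sub>R axis a 1 + z' \<tau> *\<^sub>R axis m (1::real)" for \<tau>
  have d\<gamma>: "(\<gamma> has_vector_derivative \<gamma>' \<tau>) (at \<tau> within ?I)" if "\<tau> \<in> ?I" for \<tau>
  proof -
    have "(\<gamma> has_vector_derivative 0 + u' \<tau> *\<^sub>R axis a 1 + z' \<tau> *\<^sub>R axis m 1) (at \<tau> within ?I)"
      unfolding \<gamma>_def[abs_def]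
      by (intro has_vector_derivative_add has_vector_derivative_const dz
          bounded_linear.has_vector_derivative[OF bounded_linear_scaleR_left]
          du[unfolded has_real_derivative_iff_has_vector_derivative] that)
    then show ?thesis by (simp add: \<gamma>'_def)
  qed
  have F\<gamma>: "F (\<gamma>' \<tau>) = E \<tau>" and w\<gamma>: "w (\<gamma>' \<tau>) = (E \<tau> * \<xi> \<tau> / N \<tau>) *\<^sub>R axis a 1 + (E \<tau> * k / N \<tau>) *\<^sub>R axis m 1" for \<tau>
  proof -
    let ?v = "(E \<tau> * \<xi> \<tau> / N \<tau>) *\<^sub>R axis a 1 + (E \<tau> * k / N \<tau>) *\<^sub>R axis m (1::real)"
    have v: "\<gamma>' \<tau> $ i - b * E \<tau> * e i = ?v $ i" for i
      by (simp add: \<gamma>'_def u'_def z'_def algebra_simps)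
    show *: "F (\<gamma>' \<tau>) = E \<tau>"
    proof (rule F_unique)
      show "0 \<le> E \<tau>" using E(1)[of \<tau>] by simp
      have "(\<Sum>i\<in>UNIV. (?v $ i)\<^sup>2) = ?v \<bullet> ?v" by (simp add: inner_vec_def power2_eq_square)
      also have "\<dots> = (E \<tau> * \<xi> \<tau> / N \<tau>)\<^sup>2 + (E \<tau> * k / N \<tau>)\<^sup>2"
        using a by (simp add: inner_add_left inner_add_right inner_axis_axis power2_eq_square)
      also have "\<dots> = (E \<tau>)\<^sup>2 * (k\<^sup>2 + (\<xi> \<tau>)\<^sup>2) / (N \<tau>)\<^sup>2"
        by (simp add: power_mult_distrib power_divide add_divide_distrib[symmetric] algebra_simps)
      also have "\<dots> = (E \<tau>)\<^sup>2" using N[of \<tau>] by (simp add: N2[symmetric])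
      finally show "(\<Sum>i\<in>UNIV. (\<gamma>' \<tau> $ i - b * E \<tau> * e i)\<^sup>2) = (E \<tau>)\<^sup>2" unfolding v .
      have "\<gamma>' \<tau> $ m = z' \<tau>" using a by (simp add: \<gamma>'_def axis_def)
      moreover have "0 \<le> z' \<tau>" using E(1)[of \<tau>] N[of \<tau>] k b0 by (simp add: z'_def)
      ultimately show "0 \<le> lam * E \<tau> + b * \<gamma>' \<tau> $ m"
        using E(1)[of \<tau>] lam_pos b0 by simp
    qed
    show "w (\<gamma>' \<tau>) = ?v" unfolding vec_eq_iff w_nth * v by simp
  qed
  have ne: "\<gamma>' \<tau> \<noteq> 0" for \<tau>
  proof
    assume "\<gamma>' \<tau> = 0"
    then have "F (0 *\<^sub>R axis m 1) = E \<tau>" using F\<gamma>[of \<tau>] by simp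
    then show False using F_axis[of 0] E(1)[of \<tau>] by simp
  qed
  have d\<gamma>': "(\<gamma>' has_vector_derivative (- 2) *\<^sub>R geodesic_coeff Ft (\<gamma> \<tau>) (\<gamma>' \<tau>)) (at \<tau> within ?I)"
    if \<tau>: "\<tau> \<in> ?I" for \<tau>
  proof -
    let ?f = "f (u \<tau>)"
    define U where "U = - ?f * u' \<tau> * u' \<tau> + E \<tau> * ?f / N \<tau> - ?f * u' \<tau> * \<xi> \<tau> / (N \<tau>)\<^sup>2"
    define Z where "Z = - ?f * u' \<tau> * z' \<tau> - ?f * u' \<tau> * k / (N \<tau>)\<^sup>2"
    have N0: "N \<tau> \<noteq> 0" using N[of \<tau>] by simp
    have "(u' has_real_derivative - (?f * u' \<tau>) * E \<tau> * (\<xi> \<tau> / N \<tau>)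
        + (?f * N \<tau> - \<xi> \<tau> * (\<xi> \<tau> * ?f / N \<tau>)) / (N \<tau> * N \<tau>) * E \<tau>) (at \<tau> within ?I)"
      unfolding u'_def[abs_def] by (rule DERIV_mult[OF dE[OF \<tau>, unfolded u'_def] DERIV_divide[OF d\<xi>[OF \<tau>] dN[OF \<tau>] N0]])
    moreover have "- (?f * u' \<tau>) * E \<tau> * (\<xi> \<tau> / N \<tau>)
        + (?f * N \<tau> - \<xi> \<tau> * (\<xi> \<tau> * ?f / N \<tau>)) / (N \<tau> * N \<tau>) * E \<tau> = U"
      unfolding U_def using N0 by (simp add: u'_def field_simps power2_eq_square)
    ultimately have dU: "(u' has_vector_derivative U) (at \<tau> within ?I)"
      by (simp add: has_real_derivative_iff_has_vector_derivative)
    have "(z' has_real_derivative - (?f * u' \<tau>) * E \<tau> * (k / N \<tau> + b)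
        + ((0 * N \<tau> - k * (\<xi> \<tau> * ?f / N \<tau>)) / (N \<tau> * N \<tau>) + 0) * E \<tau>) (at \<tau> within ?I)"
      unfolding z'_def[abs_def] by (intro DERIV_mult DERIV_add DERIV_divide dE dN DERIV_const \<tau> N0)
    moreover have "- (?f * u' \<tau>) * E \<tau> * (k / N \<tau> + b)
        + ((0 * N \<tau> - k * (\<xi> \<tau> * ?f / N \<tau>)) / (N \<tau> * N \<tau>) + 0) * E \<tau> = Z"
      unfolding Z_def using N0 by (simp add: u'_def z'_def field_simps power2_eq_square)
    ultimately have dZ: "(z' has_vector_derivative Z) (at \<tau> within ?I)"
      by (simp add: has_real_derivative_iff_has_vector_derivative)
    have "(\<gamma>' has_vector_derivative U *\<^sub>R axis a 1 + Z *\<^sub>R axis m 1) (at \<tau> within ?I)"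
      unfolding \<gamma>'_def[abs_def]
      by (intro has_vector_derivative_add dU dZ
          bounded_linear.has_vector_derivative[OF bounded_linear_scaleR_left])
    moreover have "(- 2) *\<^sub>R geodesic_coeff Ft (\<gamma> \<tau>) (\<gamma>' \<tau>) = U *\<^sub>R axis a 1 + Z *\<^sub>R axis m 1"
      unfolding vec_eq_iff
    proof
      fix i
      have wm: "w (\<gamma>' \<tau>) $ m = E \<tau> * k / N \<tau>" using a by (simp add: w\<gamma> axis_def)
      \<comment> \<open>F of the velocity is E by construction, so the speed is 1 automatically. The
        conservation law enters here instead: it turns Q into 1/N, which matches the spray with the
        derivatives U and Z.\<close>
      have "Q (\<gamma>' \<tau>) = E \<tau> * (N \<tau> + b * k) / N \<tau>"
        unfolding Q_eq_w F\<gamma> wm using N0 by (simp add: field_simps)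
      then have Q: "Q (\<gamma>' \<tau>) = 1 / N \<tau>" unfolding energy[OF \<tau>] using E(3)[of \<tau>] by (simp add: mult.commute)
      have r: "r (\<gamma> \<tau>) = ?f *\<^sub>R axis a 1" unfolding \<gamma>_def by (rule rf)
      have ry: "r (\<gamma> \<tau>) \<bullet> \<gamma>' \<tau> = ?f * u' \<tau>"
        unfolding r using a by (simp add: \<gamma>'_def inner_add_right inner_axis_axis)
      have G: "- 2 * geodesic_coeff Ft (\<gamma> \<tau>) (\<gamma>' \<tau>) $ i =
         - ?f * u' \<tau> * \<gamma>' \<tau> $ i + E \<tau> * (1 / N \<tau>) * (?f * axis a 1 $ i)
         - 1 / N \<tau> / E \<tau> * (?f * u' \<tau>) * w (\<gamma>' \<tau>) $ i"
        unfolding geodesic_coeff_Ft[OF ne] ry F\<gamma> Q by (simp add: r) (simp add: mult_ac)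
      have E0: "E \<tau> \<noteq> 0" using E(1)[of \<tau>] by simp
      have "- 2 * geodesic_coeff Ft (\<gamma> \<tau>) (\<gamma>' \<tau>) $ i = U * axis a 1 $ i + Z * e i"
        unfolding G w\<gamma> unfolding \<gamma>'_def U_def Z_def using E0 N0
        by (simp add: field_simps power2_eq_square)
      then show "((- 2) *\<^sub>R geodesic_coeff Ft (\<gamma> \<tau>) (\<gamma>' \<tau>)) $ i = (U *\<^sub>R axis a 1 + Z *\<^sub>R axis m 1) $ i"
        by simp
    qed
    ultimately show ?thesis by simp
  qed
  have sub: "{0..t} \<subseteq> ?I" and tI: "t \<in> ?I" using t by auto
  have geo: "unit_speed_geodesic_on Ft {0..t} \<gamma> \<gamma>'"
    unfolding unit_speed_geodesic_on_def
  proof (intro ballI conjI)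
    fix \<tau> assume "\<tau> \<in> {0..t}"
    then have \<tau>: "\<tau> \<in> ?I" using sub by blast
    show "(\<gamma> has_vector_derivative \<gamma>' \<tau>) (at \<tau> within {0..t})"
      by (rule has_vector_derivative_within_subset[OF d\<gamma>[OF \<tau>] sub])
    show "(\<gamma>' has_vector_derivative (- 2) *\<^sub>R geodesic_coeff Ft (\<gamma> \<tau>) (\<gamma>' \<tau>)) (at \<tau> within {0..t})"
      by (rule has_vector_derivative_within_subset[OF d\<gamma>'[OF \<tau>] sub])
    show "Ft (\<gamma> \<tau>) (\<gamma>' \<tau>) = 1"
      unfolding Ft_eq F\<gamma> using E(3)[of \<tau>] by (simp add: \<gamma>_def \<rho>R)
  qed
  have z0': "z 0 = 0" by (simp add: z_def)
  have \<gamma>0: "\<gamma> 0 = p + s *\<^sub>R axis a 1 + 0 *\<^sub>R axis m 1" by (simp add: \<gamma>_def u0 z0')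
  have "\<gamma> 0 \<in> M" using p a by (simp add: \<gamma>0 M_eq critical_point_def axis_def)
  moreover have "\<gamma>' 0 = nt (\<gamma> 0)"
    unfolding nt_eq \<gamma>0 \<rho>R using k by (simp add: \<gamma>'_def u'_def z'_def \<xi>0 N_def E_def u0 algebra_simps)
  ultimately have reach: "normal_geodesic_reaches Ft M nt t (\<gamma> t) (\<gamma>' t)"
    unfolding normal_geodesic_reaches_def using geo by blast
  \<comment> \<open>Second order in s for two reasons: \<xi> is of order s, so k/N differs from 1 by
    at most 2 s^2; and R is critical at u = 0, so E changes by at most 114 s^2. With 1 + b below 2
    this gives 2 + 2 * 114 = 230.\<close>
  have z'b: "\<bar>z' \<tau> - z0\<bar> \<le> 230 * s\<^sup>2" if \<tau>: "\<tau> \<in> ?I" for \<tau>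
  proof -
    have "(N \<tau> - k) * 1 \<le> (N \<tau> - k) * (N \<tau> + k)"
      using kN[of \<tau>] k by (intro mult_left_mono) auto
    also have "\<dots> = (\<xi> \<tau>)\<^sup>2" using N2[of \<tau>] by (simp add: power2_eq_square algebra_simps)
    also have "\<dots> \<le> s\<^sup>2" using bounds(3)[OF \<tau>] by (simp add: abs_le_square_iff[symmetric] s)
    finally have Nk: "N \<tau> - k \<le> s\<^sup>2" by simp
    have "\<bar>k / N \<tau> - 1\<bar> = (N \<tau> - k) / N \<tau>" using N[of \<tau>] kN[of \<tau>] by (simp add: field_simps abs_if)
    also have "\<dots> \<le> s\<^sup>2 / (1/2)" using Nk kN[of \<tau>] k by (intro frac_le) auto
    finally have 1: "\<bar>k / N \<tau> - 1\<bar> \<le> 2 * s\<^sup>2" by simp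
    have "z' \<tau> - z0 = E \<tau> * (k / N \<tau> - 1) + (1 + b) * (E \<tau> - exp (- R 0))"
      by (simp add: z'_def z0_def \<rho>p algebra_simps)
    also have "\<bar>\<dots>\<bar> \<le> E \<tau> * \<bar>k / N \<tau> - 1\<bar> + (1 + b) * \<bar>E \<tau> - exp (- R 0)\<bar>"
      using E(1)[of \<tau>] b by (intro order_trans[OF abs_triangle_ineq]) (simp add: abs_mult)
    also have "\<dots> \<le> 1 * (2 * s\<^sup>2) + 2 * (114 * s\<^sup>2)"
      using E[of \<tau>] 1 b1 bounds(5)[OF \<tau>] by (intro add_mono mult_mono) (auto simp: E_def)
    finally show ?thesis by simp
  qed
  have "((\<lambda>\<tau>. z \<tau> - \<tau> * z0) has_vector_derivative z' \<tau> - z0) (at \<tau> within ?I)" if "\<tau> \<in> ?I" for \<tau>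
    by (auto intro!: derivative_eq_intros dz that)
  from mvt_vector_derivative[OF this tI] obtain x where x: "x \<in> {0..t}" "z t - t * z0 = t * (z' x - z0)"
    by (auto simp: z0')
  have \<zeta>: "\<bar>z t - t * z0\<bar> \<le> 230 * s\<^sup>2"
  proof -
    have "\<bar>t * (z' x - z0)\<bar> \<le> 1 * (230 * s\<^sup>2)"
      unfolding abs_mult using t x(1) sub z'b[of x] by (intro mult_mono) auto
    then show ?thesis by (simp add: x(2))
  qed
  have v: "exp (- 2 * (CARD('n) * ln 3)) * (2/3 * s * t) \<le> - \<sigma> * u' t"
  proof -
    \<comment> \<open>The conservation law bounds N above by exp (R u), hence E/N below by exp (- 2
      R), which \<open>\<rho>_le\<close> makes uniform.\<close>
    have "0 \<le> b * k" using b0 k by simp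
    then have "N t \<le> exp (R (u t))" using energy[OF tI] by linarith
    then have "E t / exp (R (u t)) \<le> E t / N t"
      using N[of t] E(1)[of t] by (intro divide_left_mono) auto
    moreover have "E t / exp (R (u t)) = exp (- 2 * R (u t))"
      by (simp add: E_def exp_diff[symmetric])
    moreover have "exp (- 2 * (CARD('n) * ln 3)) \<le> exp (- 2 * R (u t))"
      using \<rho>_le[of "p + u t *\<^sub>R axis a 1 + 0 *\<^sub>R axis m 1"] unfolding \<rho>R by simp
    ultimately have "exp (- 2 * (CARD('n) * ln 3)) \<le> E t / N t" by linarith
    moreover have "2/3 * s * t \<le> - \<sigma> * \<xi> t" by (rule bounds(4)[OF tI])
    ultimately have "exp (- 2 * (CARD('n) * ln 3)) * (2/3 * s * t) \<le> E t / N t * (- \<sigma> * \<xi> t)"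
      by (rule mult_mono) (use s t E(1)[of t] N[of t] in simp_all)
    also have "E t / N t * (- \<sigma> * \<xi> t) = - \<sigma> * u' t" by (simp add: u'_def)
    finally show ?thesis .
  qed
  show ?thesis
  proof (intro exI conjI)
    show "normal_geodesic_reaches Ft M nt t
      (p + u t *\<^sub>R axis a 1 + (t * ((1 + b) * exp (- \<rho> p)) + (z t - t * z0)) *\<^sub>R axis m 1)
      (u' t *\<^sub>R axis a 1 + ((1 + b) * exp (- \<rho> p) + (z' t - z0)) *\<^sub>R axis m 1)"
      using reach by (simp add: \<gamma>_def \<gamma>'_def z0_def)
    have "\<bar>u' t\<bar> = E t * (\<bar>\<xi> t\<bar> / N t)"
      using E(1)[of t] N[of t] by (simp add: u'_def abs_mult abs_divide)
    also have "\<dots> \<le> 1 * (s / (1/2))"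
      using E[of t] N[of t] kN[of t] k bounds(3)[OF tI] s by (intro mult_mono frac_le) auto
    finally show "\<bar>u' t\<bar> \<le> 2 * s" by simp
  qed (use bounds(1,2)[OF tI] \<zeta> z'b[OF tI] v in auto)
qed

end

section \<open>Mean curvature of the parallel hypersurfaces\<close>

text \<open>Within a hypersurface \<open>frechet_derivative\<close> is an arbitrary choice off the
  tangent directions. Along e its value is forced, since S contains points approaching x in exactly
  that direction.\<close>

lemma frechet_derivative_direction:
  fixes f :: "'a::real_normed_vector \<Rightarrow> 'b::real_normed_vector"
  assumes D: "(f has_derivative D) (at x within S)"
    and X: "\<And>n. x + c n *\<^sub>R e \<in> S" "\<And>n. c n \<noteq> 0" "c \<longlonglongrightarrow> 0"
  shows "frechet_derivative f (at x within S) e = D e"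
proof -
  have D': "(f has_derivative frechet_derivative f (at x within S)) (at x within S)"
    using D frechet_derivative_works differentiableI by blast
  have lim: "(\<lambda>n. (x + c n *\<^sub>R e - x) /\<^sub>R c n) \<longlonglongrightarrow> e" using X(2) by simp
  show ?thesis
    using LIMSEQ_unique[OF has_derivative_sequence[OF D' X lim] has_derivative_sequence[OF D X lim]] .
qed

context randers_conformal
begin

section \<open>The hyperplane M and its vanishing principal curvatures\<close>

text \<open>Writes the coefficient of \<open>nt\<close> as a product of functions covered by
  \<open>Ck_on_trig\<close>, for its smoothness.\<close>

lemma exp_minus_\<rho>: "exp (- \<rho> x) = (\<Prod>a\<in>UNIV - {m}. inverse (2 + cos (pi * x $ a)))"
proof -
  have "exp (- ln (2 + cos (pi * x $ a))) = inverse (2 + cos (pi * x $ a))" for a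
    using two_cos_pos[of "pi * x $ a"] by (simp add: exp_minus)
  then show ?thesis by (simp add: \<rho>_eq sum_negf[symmetric] exp_sum)
qed

lemma nt_deriv: "(nt has_derivative (\<lambda>h. (- ((1 + b) * exp (- \<rho> x) * (r x \<bullet> h))) *\<^sub>R axis m 1)) (at x)"
proof -
  have "((\<lambda>x. exp (- \<rho> x)) has_derivative (\<lambda>h. exp (- \<rho> x) * - (r x \<bullet> h))) (at x)"
    using has_derivative_exp[OF has_derivative_minus[OF \<rho>_deriv[of x]]] by (simp add: mult.commute)
  from has_derivative_scaleR_left[OF has_derivative_mult_right[OF this, of "1 + b"], of "axis m 1"]
  show ?thesis unfolding nt_eq by (simp add: mult.assoc)
qed

lemma nt_value: "nt x = ((1 + b) * exp (- \<rho> x)) *\<^sub>R axis m 1" "0 < (1 + b) * exp (- \<rho> x)"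
  using b0 by (simp_all add: nt_eq)

lemma Ft_nt: "Ft x (nt x) = 1"
proof -
  have "F (nt x) = exp (- \<rho> x)"
    unfolding nt_value(1) using b0 F_axis[of "(1 + b) * exp (- \<rho> x)"] by simp
  then show ?thesis by (simp add: Ft_eq exp_minus_inverse)
qed

lemma smooth_nt: "smooth_on UNIV nt"
proof -
  have "Ck_on k UNIV (\<lambda>x. ((1 + b) * e i) * (\<Prod>a\<in>UNIV - {m}. inverse (2 + cos (pi * x $ a))))" for k i
    by (intro Ck_on_mult Ck_on_const Ck_on_prod) (use Ck_on_trig in auto)
  moreover have "(\<lambda>x. nt x $ i) = (\<lambda>x. ((1 + b) * e i) * (\<Prod>a\<in>UNIV - {m}. inverse (2 + cos (pi * x $ a))))" for i
    by (simp add: nt_eq exp_minus_\<rho> fun_eq_iff)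
  ultimately show ?thesis by (simp add: smooth_on_def)
qed

lemma embedded_M: "embedded_hypersurface M"
  unfolding embedded_hypersurface_def
proof
  fix p assume "p \<in> M"
  let ?v = "x0 *\<^sub>R axis m (1::real) :: real^'n"
  have hom: "homeomorphism UNIV UNIV (\<lambda>x. x - ?v) (\<lambda>x. x + ?v)"
    by (auto simp: homeomorphism_def intro!: continuous_intros surjI[of _ "\<lambda>x. x + ?v"] surjI[of _ "\<lambda>x. x - ?v"])
  have sm: "smooth_on UNIV (\<lambda>x. x - ?v)" "smooth_on UNIV (\<lambda>x. x + ?v)"
    unfolding smooth_on_def
    using Ck_on_coord[of _ i "- (x0 * e i)" for i] Ck_on_coord[of _ i "x0 * e i" for i]
    by (auto simp del: Ck_on.simps)
  have "y \<in> (\<lambda>x. x - ?v) ` M" if "y $ m = 0" for y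
    using that by (intro image_eqI[of _ _ "y + ?v"]) (auto simp: M_eq)
  then have im: "(\<lambda>x. x - ?v) ` (M \<inter> UNIV) = {y \<in> UNIV. y $ m = 0}"
    by (auto simp: M_eq)
  show "\<exists>U V \<Phi> \<Psi> k. open U \<and> open V \<and> p \<in> U \<and> homeomorphism U V \<Phi> \<Psi> \<and>
      smooth_on U \<Phi> \<and> smooth_on V \<Psi> \<and> \<Phi> ` (M \<inter> U) = {y \<in> V. y $ k = 0}"
    by (intro exI conjI) (rule open_UNIV open_UNIV UNIV_I hom sm im)+
qed

lemma tangent_M: "X \<in> tangent_space M p \<Longrightarrow> X $ m = 0"
proof -
  assume "X \<in> tangent_space M p"
  then obtain c d where d: "0 < d" "\<And>t. \<bar>t\<bar> < d \<Longrightarrow> c t \<in> M" and c: "(c has_vector_derivative X) (at 0)"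
    by (auto simp: tangent_space_def)
  have "((\<lambda>t. c t $ m) has_vector_derivative X $ m) (at 0)"
    by (rule bounded_linear.has_vector_derivative[OF bounded_linear_vec_nth c])
  moreover have "((\<lambda>t. c t $ m) has_vector_derivative 0) (at 0)"
  proof (rule has_vector_derivative_transform_within_open[of "\<lambda>_. x0" _ _ "ball 0 d"])
    show "x0 = c t $ m" if "t \<in> ball 0 d" for t using d(2)[of t] that by (auto simp: M_eq)
  qed (use d(1) in auto)
  ultimately show "X $ m = 0" by (rule vector_derivative_unique_at)
qed

lemma normal_M: "normal_hypersurface Ft M nt"
proof -
  have "finsler_inner Ft p (nt p) (nt p) X = 0" if "X \<in> tangent_space M p" for p X
    using tangent_M[OF that] finsler_inner_axis[OF nt_value(2)] by (simp add: nt_value(1))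
  moreover have "smooth_along M nt"
    unfolding smooth_along_def using smooth_nt by (intro ballI exI[of _ UNIV] exI[of _ nt]) auto
  ultimately show ?thesis
    unfolding normal_hypersurface_def unit_normal_field_def using embedded_M Ft_nt by blast
qed

text \<open>The inner product of such a normal with X is a positive multiple of
  \<open>X $ m\<close>, so orthogonality gives one inclusion and \<open>tangent_space_chart\<close>
  the other. It covers both M and the parallel hypersurfaces, for which no description near x is at
  hand.\<close>

lemma tangent_space_axis_normal:
  assumes S: "normal_hypersurface Ft S \<nu>" "x \<in> S" and \<nu>: "\<nu> x = c *\<^sub>R axis m 1" "0 < c"
  shows "tangent_space S x = {X. X $ m = 0}"
proof (rule tangent_space_chart)
  show "embedded_hypersurface S" using S by (simp add: normal_hypersurface_def)
  have "X $ m = 0" if "X \<in> tangent_space S x" for X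
  proof -
    have "finsler_inner Ft x (\<nu> x) (\<nu> x) X = 0"
      using S that unfolding normal_hypersurface_def unit_normal_field_def by blast
    moreover have "exp (2 * \<rho> x) * c / (1 + b)\<^sup>2 \<noteq> 0" using \<nu>(2) b0 by simp
    ultimately show ?thesis unfolding \<nu>(1) finsler_inner_axis[OF \<nu>(2)] by simp
  qed
  then show "tangent_space S x \<subseteq> {X. X $ m = 0}" by blast
qed (rule S)

lemma constant_principal_curvatures_M: "constant_principal_curvatures Ft M nt"
proof -
  have "principal_curvatures Ft M nt p = image_mset (\<lambda>_. 0) (mset_set (UNIV - {m}))" if p: "p \<in> M" for p
  proof (rule principal_curvatures_diag)
    show "tangent_space M p = {X. X $ m = 0}"
      by (rule tangent_space_axis_normal[OF normal_M p nt_value])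
    fix X :: "real^'n" assume X: "X $ m = 0"
    have "frechet_derivative nt (at p within M) X = (- ((1 + b) * exp (- \<rho> p) * (r p \<bullet> X))) *\<^sub>R axis m 1"
    proof (rule frechet_derivative_direction[where c = "\<lambda>n. inverse (real (Suc n))"])
      show "(nt has_derivative (\<lambda>h. (- ((1 + b) * exp (- \<rho> p) * (r p \<bullet> h))) *\<^sub>R axis m 1)) (at p within M)"
        by (rule has_derivative_at_withinI[OF nt_deriv])
      show "p + inverse (real (Suc n)) *\<^sub>R X \<in> M" for n using p X by (simp add: M_eq)
      show "(\<lambda>n. inverse (real (Suc n))) \<longlonglongrightarrow> 0" by (rule LIMSEQ_inverse_real_of_nat)
    qed simp
    moreover have "nonlinear_connection Ft p (nt p) *v X = ((1 + b) * exp (- \<rho> p) * (r p \<bullet> X)) *\<^sub>R axis m 1"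
      unfolding nt_value(1) by (rule nonlinear_connection_axis[OF nt_value(2) X])
    ultimately show "shape_operator Ft M nt p X = (\<chi> i. 0 * X $ i)"
      by (simp add: shape_operator_def vec_eq_iff)
  qed
  then show ?thesis
    unfolding constant_principal_curvatures_def
    by (intro exI[of _ "image_mset (\<lambda>_. 0) (mset_set (UNIV - {m}))"]) (simp add: card_Diff_singleton)
qed

section \<open>Sign of the mean curvature over critical points\<close>

text \<open>Geodesics issuing from p displaced by s along \<open>axis a 1\<close> reach points whose
  offset from x is U along \<open>axis a 1\<close> up to an error of order s^2, while the velocity
  changes by V along \<open>axis a 1\<close> up to such an error. The quotient V/U converges because
  the field is differentiable; its sign comes from a uniform bound.\<close>

lemma normal_derivative_critical:
  assumes p: "critical_point \<sigma> p" and a: "a \<noteq> m" and t: "0 < t" "t \<le> 1/100"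
    and \<nu>: "\<forall>x v. normal_geodesic_reaches Ft M nt t x v \<longrightarrow> \<nu> x = v"
  defines "x \<equiv> p + (t * ((1 + b) * exp (- \<rho> p))) *\<^sub>R axis m 1"
  assumes D: "(\<nu> has_derivative D) (at x within parallel_hypersurface Ft M nt t)"
  shows "x \<in> parallel_hypersurface Ft M nt t" and "\<nu> x = ((1 + b) * exp (- \<rho> p)) *\<^sub>R axis m 1"
    and "\<exists>d. D (axis a 1) = d *\<^sub>R axis a 1 \<and> 0 < - \<sigma> * d"
proof -
  define c where "c = (1 + b) * exp (- \<rho> p)"
  define C where "C = exp (- 2 * (real CARD('n) * ln 3))"
  note family = geodesic_family[OF p a _ _ t, folded c_def C_def]
  have x: "x = p + (t * c) *\<^sub>R axis m 1" by (simp add: x_def c_def)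
  \<comment> \<open>For s = 0 the bounds force all four parameters to vanish, which yields the
    straight geodesic over p.\<close>
  from family[of 0]
  have 0: "normal_geodesic_reaches Ft M nt t x (c *\<^sub>R axis m 1)" by (auto simp: x)
  show "x \<in> parallel_hypersurface Ft M nt t" using 0 by (auto simp: parallel_hypersurface_def)
  show "\<nu> x = ((1 + b) * exp (- \<rho> p)) *\<^sub>R axis m 1" using \<nu>[rule_format, OF 0] by (simp add: c_def)
  define s where "s n = inverse (real (Suc n)) / 8" for n
  have s: "0 < s n" "s n \<le> 1/8" for n by (simp_all add: s_def field_simps)
  have s0: "s \<longlonglongrightarrow> 0"
    unfolding s_def[abs_def] using tendsto_divide[OF LIMSEQ_inverse_real_of_nat tendsto_const[of 8]] by simp
  have "\<forall>n. \<exists>u v \<zeta> \<eta>. normal_geodesic_reaches Ft M nt t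
      (p + u *\<^sub>R axis a 1 + (t * c + \<zeta>) *\<^sub>R axis m 1) (v *\<^sub>R axis a 1 + (c + \<eta>) *\<^sub>R axis m 1) \<and>
    2/3 * s n \<le> u \<and> u \<le> 4/3 * s n \<and> \<bar>\<zeta>\<bar> \<le> 230 * (s n)\<^sup>2 \<and> \<bar>\<eta>\<bar> \<le> 230 * (s n)\<^sup>2 \<and>
    C * (2/3 * s n * t) \<le> - \<sigma> * v"
  proof
    fix n
    show "\<exists>u v \<zeta> \<eta>. normal_geodesic_reaches Ft M nt t
      (p + u *\<^sub>R axis a 1 + (t * c + \<zeta>) *\<^sub>R axis m 1) (v *\<^sub>R axis a 1 + (c + \<eta>) *\<^sub>R axis m 1) \<and>
    2/3 * s n \<le> u \<and> u \<le> 4/3 * s n \<and> \<bar>\<zeta>\<bar> \<le> 230 * (s n)\<^sup>2 \<and> \<bar>\<eta>\<bar> \<le> 230 * (s n)\<^sup>2 \<and>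
    C * (2/3 * s n * t) \<le> - \<sigma> * v"
      using family[OF less_imp_le[OF s(1)] s(2), of n] by (elim exE conjE) (intro exI conjI)
  qed
  then obtain U V Z H where reach: "\<And>n. normal_geodesic_reaches Ft M nt t
      (p + U n *\<^sub>R axis a 1 + (t * c + Z n) *\<^sub>R axis m 1) (V n *\<^sub>R axis a 1 + (c + H n) *\<^sub>R axis m 1)"
    and U: "\<And>n. 2/3 * s n \<le> U n" "\<And>n. U n \<le> 4/3 * s n"
    and Z: "\<And>n. \<bar>Z n\<bar> \<le> 230 * (s n)\<^sup>2" and H: "\<And>n. \<bar>H n\<bar> \<le> 230 * (s n)\<^sup>2"
    and V: "\<And>n. C * (2/3 * s n * t) \<le> - \<sigma> * V n"
    by (simp only: choice_iff) blast
  have Upos: "0 < U n" for n using U(1)[of n] s(1)[of n] by linarith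
  \<comment> \<open>Errors of order s^2 divided by U, which is at least 2/3 s; 345 is 230 times
    3/2.\<close>
  have small: "(\<lambda>n. Y n / U n) \<longlonglongrightarrow> 0" if Y: "\<And>n. \<bar>Y n\<bar> \<le> 230 * (s n)\<^sup>2" for Y
  proof (rule Lim_null_comparison)
    show "\<forall>\<^sub>F n in sequentially. norm (Y n / U n) \<le> 345 * s n"
    proof (rule always_eventually, rule allI)
      fix n
      have "\<bar>Y n\<bar> / U n \<le> (230 * (s n)\<^sup>2) / (2/3 * s n)"
        using Y[of n] U(1)[of n] s(1)[of n] by (intro frac_le) auto
      also have "\<dots> = 345 * s n" using s(1)[of n] by (simp add: power2_eq_square)
      finally show "norm (Y n / U n) \<le> 345 * s n" using Upos[of n] by (simp add: abs_divide)
    qed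
    show "(\<lambda>n. 345 * s n) \<longlonglongrightarrow> 0" using tendsto_mult_right_zero[OF s0] by blast
  qed
  have U0: "U \<longlonglongrightarrow> 0"
  proof (rule Lim_null_comparison)
    show "\<forall>\<^sub>F n in sequentially. norm (U n) \<le> 4/3 * s n"
      by (rule always_eventually) (use U(2) Upos in \<open>auto simp: abs_of_pos\<close>)
    show "(\<lambda>n. 4/3 * s n) \<longlonglongrightarrow> 0" using tendsto_mult_right_zero[OF s0] by blast
  qed
  define X where "X n = p + U n *\<^sub>R axis a 1 + (t * c + Z n) *\<^sub>R axis m (1::real)" for n
  have "(\<lambda>n. axis a 1 + (Z n / U n) *\<^sub>R axis m (1::real)) \<longlonglongrightarrow> axis a 1 + 0 *\<^sub>R axis m 1"
    by (intro tendsto_intros small Z)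
  moreover have "(X n - x) /\<^sub>R U n = axis a 1 + (Z n / U n) *\<^sub>R axis m 1" for n
    using Upos[of n] by (simp add: X_def x algebra_simps divide_inverse)
  ultimately have lim: "(\<lambda>n. (X n - x) /\<^sub>R U n) \<longlonglongrightarrow> axis a 1" by simp
  have XS: "X n \<in> parallel_hypersurface Ft M nt t" for n
    using reach[of n] by (auto simp: parallel_hypersurface_def X_def)
  have "(\<lambda>n. (\<nu> (X n) - \<nu> x) /\<^sub>R U n) \<longlonglongrightarrow> D (axis a 1)"
    by (rule has_derivative_sequence[OF D XS _ U0 lim]) (use Upos in \<open>simp add: less_imp_neq[symmetric]\<close>)
  moreover have "(\<nu> (X n) - \<nu> x) /\<^sub>R U n = (V n / U n) *\<^sub>R axis a 1 + (H n / U n) *\<^sub>R axis m 1" for n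
    unfolding X_def \<nu>[rule_format, OF reach] \<nu>[rule_format, OF 0] by (simp add: algebra_simps divide_inverse)
  ultimately have lim': "(\<lambda>n. (V n / U n) *\<^sub>R axis a 1 + (H n / U n) *\<^sub>R axis m 1) \<longlonglongrightarrow> D (axis a 1)"
    by simp
  have comp: "(\<lambda>n. V n / U n * axis a 1 $ i + H n / U n * e i) \<longlonglongrightarrow> D (axis a 1) $ i" for i
    using tendsto_vec_nth[OF lim', of i] by simp
  have "D (axis a 1) $ i = 0" if i: "i \<noteq> a" for i
  proof -
    have "(\<lambda>n. H n / U n * e i) \<longlonglongrightarrow> 0 * e i" by (intro tendsto_intros small H)
    moreover have "(\<lambda>n. H n / U n * e i) \<longlonglongrightarrow> D (axis a 1) $ i"
      using comp[of i] i by (simp add: axis_def)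
    ultimately show ?thesis using LIMSEQ_unique by fastforce
  qed
  then have Da: "D (axis a 1) = (D (axis a 1) $ a) *\<^sub>R axis a 1"
    by (auto simp: vec_eq_iff axis_def)
  have "(\<lambda>n. V n / U n) \<longlonglongrightarrow> D (axis a 1) $ a"
    using comp[of a] a by (simp add: axis_def)
  then have "(\<lambda>n. - \<sigma> * (V n / U n)) \<longlonglongrightarrow> - \<sigma> * (D (axis a 1) $ a)" by (intro tendsto_intros)
  \<comment> \<open>The factor s cancels between the lower bound for V and the upper bound 4/3 s for
    U, so the bound is positive uniformly in n and passes to the limit.\<close>
  moreover have "C * t / 2 \<le> - \<sigma> * (V n / U n)" for n
  proof -
    have "C * t / 2 = (C * (2/3 * s n * t)) / (4/3 * s n)" using s(1)[of n] by simp
    also have "\<dots> \<le> (- \<sigma> * V n) / U n"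
    proof (rule frac_le)
      have "0 < C * (2/3 * s n * t)" using s(1)[of n] t by (simp add: C_def)
      then show "0 \<le> - \<sigma> * V n" using V[of n] by linarith
    qed (use V U Upos in auto)
    finally show ?thesis by simp
  qed
  ultimately have "C * t / 2 \<le> - \<sigma> * (D (axis a 1) $ a)"
    by (intro LIMSEQ_le_const) auto
  moreover have "0 < C * t / 2" using t by (simp add: C_def)
  ultimately show "\<exists>d. D (axis a 1) = d *\<^sub>R axis a 1 \<and> 0 < - \<sigma> * d"
    using Da by (intro exI[of _ "D (axis a 1) $ a"]) auto
qed

text \<open>Over the critical point r vanishes, so the nonlinear connection contributes nothing on
  tangent vectors and the shape operator is minus the derivative of \<nu>. By
  \<open>normal_derivative_critical\<close> this is diagonal in the coordinate axes, with all
  entries of the sign of \<sigma>; two dimensions guarantee at least one entry.\<close>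

lemma parallel_mean_curvature_sign:
  assumes p: "critical_point \<sigma> p" and card: "2 \<le> CARD('n)" and t: "0 < t" "t \<le> 1/100"
    and \<nu>: "\<forall>x v. normal_geodesic_reaches Ft M nt t x v \<longrightarrow> \<nu> x = v"
    and S: "normal_hypersurface Ft (parallel_hypersurface Ft M nt t) \<nu>"
  shows "\<exists>x\<in>parallel_hypersurface Ft M nt t. r x = 0 \<and> (\<exists>c>0. \<nu> x = c *\<^sub>R axis m 1) \<and>
    0 < \<sigma> * anisotropic_mean_curvature Ft (parallel_hypersurface Ft M nt t) \<nu> x"
proof -
  define S where "S = parallel_hypersurface Ft M nt t"
  define c where "c = (1 + b) * exp (- \<rho> p)"
  define x where "x = p + (t * c) *\<^sub>R axis m 1"
  have c: "0 < c" using b0 by (simp add: c_def)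
  have "UNIV - {m} \<noteq> {}"
  proof
    assume "UNIV - {m} = {}"
    then have "(UNIV :: 'n set) = {m}" by auto
    then have "CARD('n) = card {m}" by simp
    then show False using card by simp
  qed
  then obtain a where a: "a \<noteq> m" by auto
  note main = normal_derivative_critical[where \<nu> = \<nu>, OF p _ t \<nu>, folded c_def, folded x_def, folded S_def]
  have r: "r x = 0" unfolding x_def by (rule critical_point_r[OF p])
  have "\<exists>u v \<zeta> \<eta>. normal_geodesic_reaches Ft M nt t (p + u *\<^sub>R axis a 1 + (t * c + \<zeta>) *\<^sub>R axis m 1) v \<and> u = 0 \<and> \<zeta> = 0"
    using geodesic_family[OF p a _ _ t, of 0] by (fastforce simp: c_def)
  then have xS: "x \<in> S" by (auto simp: S_def parallel_hypersurface_def x_def)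
  \<comment> \<open>\<nu> is smooth only along S. Near x it agrees on S with a smooth h, whose
    derivative serves as a derivative of \<nu> within S.\<close>
  obtain U h where U: "open U" "x \<in> U" "smooth_on U h" "\<And>y. y \<in> S \<inter> U \<Longrightarrow> \<nu> y = h y"
    using S xS unfolding normal_hypersurface_def unit_normal_field_def smooth_along_def S_def[symmetric] by metis
  obtain h' where "(h has_derivative h') (at x)"
    using smooth_on_differentiable[OF U(3,2)] by (auto simp: differentiable_def)
  then have "(h has_derivative h') (at x within S)" by (rule has_derivative_at_withinI)
  moreover obtain d where "0 < d" "ball x d \<subseteq> U" using U(1,2) by (rule openE)
  ultimately have "(\<nu> has_derivative h') (at x within S)"
    by (elim has_derivative_transform_within[of _ _ _ _ d]) (use xS U(4) in \<open>auto simp: subset_iff dist_commute\<close>)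
  then have D: "(\<nu> has_derivative frechet_derivative \<nu> (at x within S)) (at x within S)"
    using frechet_derivative_works differentiableI by blast
  define D where "D = frechet_derivative \<nu> (at x within S)"
  note D = D[folded D_def]
  have \<nu>x: "\<nu> x = c *\<^sub>R axis m 1" using main(2)[OF a D] .
  have "\<forall>a. \<exists>d. a \<noteq> m \<longrightarrow> D (axis a 1) = d *\<^sub>R axis a 1 \<and> 0 < - \<sigma> * d"
    using main(3)[OF _ D] by blast
  then obtain d where d: "\<And>a. a \<noteq> m \<Longrightarrow> D (axis a 1) = d a *\<^sub>R axis a 1 \<and> 0 < - \<sigma> * d a" by metis
  have lin: "linear D" using D by (rule has_derivative_linear)
  have "principal_curvatures Ft S \<nu> x = image_mset (\<lambda>i. - d i) (mset_set (UNIV - {m}))"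
  proof (rule principal_curvatures_diag)
    show "tangent_space S x = {X. X $ m = 0}"
      by (rule tangent_space_axis_normal[OF S[folded S_def] xS \<nu>x c])
    fix X :: "real^'n" assume X: "X $ m = 0"
    have "D X = D (\<Sum>i\<in>UNIV. X $ i *\<^sub>R axis i 1)"
      using basis_expansion[of X] by (simp add: scalar_mult_eq_scaleR)
    also have "\<dots> = (\<Sum>i\<in>UNIV. X $ i *\<^sub>R D (axis i 1))"
      by (simp add: linear_sum[OF lin] linear_scale[OF lin])
    also have "\<dots> = (\<Sum>i\<in>UNIV. (d i * X $ i) *\<^sub>R axis i 1)"
    proof (rule sum.cong[OF refl])
      fix i
      show "X $ i *\<^sub>R D (axis i 1) = (d i * X $ i) *\<^sub>R axis i 1"
        using d[of i] X by (cases "i = m") auto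
    qed
    also have "\<dots> = (\<chi> i. d i * X $ i)"
      using basis_expansion[of "\<chi> i. d i * X $ i"] by (simp add: scalar_mult_eq_scaleR)
    finally have DX: "D X = (\<chi> i. d i * X $ i)" .
    have "nonlinear_connection Ft x (\<nu> x) *v X = 0"
      unfolding \<nu>x nonlinear_connection_axis[OF c X] r by simp
    then show "shape_operator Ft S \<nu> x X = (\<chi> i. - d i * X $ i)"
      by (simp add: shape_operator_def D_def[symmetric] DX vec_eq_iff)
  qed
  then have "anisotropic_mean_curvature Ft S \<nu> x = (\<Sum>i\<in>UNIV - {m}. - d i)"
    by (simp add: anisotropic_mean_curvature_def sum_unfold_sum_mset)
  then have "\<sigma> * anisotropic_mean_curvature Ft S \<nu> x = (\<Sum>i\<in>UNIV - {m}. - \<sigma> * d i)"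
    by (simp add: sum_distrib_left)
  also have "0 < (\<Sum>i\<in>UNIV - {m}. - \<sigma> * d i)"
    by (rule sum_pos) (use d a in auto)
  finally show ?thesis using xS r \<nu>x c unfolding S_def by blast
qed

text \<open>Stated for any H that equals the anisotropic mean curvature wherever r vanishes and the
  normal is a positive multiple of \<open>axis m 1\<close>, so that one argument refutes both
  notions.\<close>

lemma not_parallels_have_constant_curvature:
  assumes card: "2 \<le> CARD('n)"
    and H: "\<And>S \<nu> x c. r x = 0 \<Longrightarrow> 0 < c \<Longrightarrow> \<nu> x = c *\<^sub>R axis m 1 \<Longrightarrow>
      H S \<nu> x = anisotropic_mean_curvature Ft S \<nu> x"
  shows "\<not> parallels_have_constant_curvature H Ft M nt"
proof
  assume "parallels_have_constant_curvature H Ft M nt"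
  then obtain \<epsilon> where \<epsilon>: "0 < \<epsilon>" and par: "\<And>t. 0 < t \<Longrightarrow> t < \<epsilon> \<Longrightarrow>
      \<exists>\<nu>'. (\<forall>x v. normal_geodesic_reaches Ft M nt t x v \<longrightarrow> \<nu>' x = v) \<and>
        has_constant_curvature H Ft (parallel_hypersurface Ft M nt t) \<nu>'"
    unfolding parallels_have_constant_curvature_def by blast
  define t where "t = min (\<epsilon> / 2) (1/100)"
  have t: "0 < t" "t < \<epsilon>" "t \<le> 1/100" using \<epsilon> by (auto simp: t_def)
  let ?S = "parallel_hypersurface Ft M nt t"
  obtain \<nu> c where \<nu>: "\<forall>x v. normal_geodesic_reaches Ft M nt t x v \<longrightarrow> \<nu> x = v"
    and S: "normal_hypersurface Ft ?S \<nu>" and c: "\<And>x. x \<in> ?S \<Longrightarrow> H ?S \<nu> x = c"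
    using par[OF t(1,2)] unfolding has_constant_curvature_def by blast
  have "0 < \<sigma> * c" if p: "critical_point \<sigma> p" for \<sigma> p
    using parallel_mean_curvature_sign[OF p card t(1,3) \<nu> S] H c by metis
  \<comment> \<open>The coordinates 0 and 1 are the extrema of cos (pi x); a single t and a single
    constant c serve over both points, so c would be positive and negative.\<close>
  moreover have "critical_point 1 (\<chi> i. if i = m then x0 else 0)"
    and "critical_point (- 1) (\<chi> i. if i = m then x0 else 1)"
    by (auto simp: critical_point_def)
  ultimately have "0 < 1 * c" "0 < - 1 * c" by blast+
  then show False by simp
qed

end

theorem mainTheorem2:
  fixes b lam x0 :: real
    and m :: "'n::finite"
    and F :: "real^'n \<Rightarrow> real"
    and \<rho> :: "real^'n \<Rightarrow> real"
    and Ft :: "real^'n \<Rightarrow> real^'n \<Rightarrow> real"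
    and M :: "(real^'n) set"
    and nt :: "real^'n \<Rightarrow> real^'n"
  assumes "CARD('n) \<ge> 2"
    and "0 \<le> b" and "b < 1" and "lam = 1 - b\<^sup>2"
    and "F = (\<lambda>y. (sqrt (lam * (\<Sum>i\<in>UNIV. (y $ i)\<^sup>2) + b\<^sup>2 * (y $ m)\<^sup>2) - b * y $ m) / lam)"
    and "\<rho> = (\<lambda>x. \<Sum>a\<in>UNIV - {m}. ln (2 + cos (pi * x $ a)))"
    and "Ft = (\<lambda>x y. exp (\<rho> x) * F y)"
    and "M = {x. x $ m = x0}"
    and "nt = (\<lambda>x. ((1 + b) * exp (- \<rho> x)) *\<^sub>R axis m 1)"
  shows "normal_hypersurface Ft M nt
    \<and> constant_principal_curvatures Ft M nt
    \<and> \<not> isoparametric Ft M nt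
    \<and> \<not> dmu_isoparametric Ft (busemann_hausdorff Ft) M nt"
proof -
  interpret randers_conformal b lam x0 m F \<rho> Ft M nt
    by unfold_locales (use assms in blast)+
  have "\<not> isoparametric Ft M nt"
    unfolding isoparametric_def
    by (rule not_parallels_have_constant_curvature[OF assms(1)]) (rule refl)
  moreover have "\<not> dmu_isoparametric Ft (busemann_hausdorff Ft) M nt"
    unfolding dmu_isoparametric_def
    by (rule not_parallels_have_constant_curvature[OF assms(1)])
      (simp add: dmu_mean_curvature_def S_curvature_critical)
  ultimately show ?thesis
    using normal_M constant_principal_curvatures_M by blast
qed

end
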